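(* Fix the rainbow $(1,2,3,4,5)$ for the $N=5$ hypercube Adinkra $H^5$, and let $k\in\{1,\dots,5\}$. The images under $\nu_k$ of the face centers and vertices of $H^5$ in the Mordell–Weil group $E_k(K_k)$ lie in a subgroup $G_k$ isomorphic to $\mathbb{Z}\times\mathbb{Z}/(4)\times\mathbb{Z}/(2)$, such that: A. The projection to $\mathbb{Z}$ of the image of any (black or white) vertex $u$ is a generator of $\mathbb{Z}$. The sign of this projection is determined by the $k$-th component $S_{k,\mathbf 1}(u)$ of the total-color-splitting of $H^5$ with starting vertex $\mathbf 1=(1,1,1,1,1)$: within the vertices of one color (black or white), two vertices have equal projections if and only if they have the same label under $S_{k,\mathbf 1}$. B. The torsion subgroup of $G_k$ is generated by the images of the face centers. The face centers corresponding to one pair of adjacent edge colors in the rainbow are mapped to the identity of $E_k$, the face centers corresponding to another pair of adjacent edge colors are mapped to points of order $4$, and the face centers corresponding to the remaining pairs of adjacent edge colors are mapped to points of order $2$.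
   Context: **Hypercube.** Color indices are taken modulo 5 in $\{1,\dots,5\}$. $H^5$ is the graph on $\{0,1\}^5$ with two vertices adjacent iff they differ in exactly one coordinate; an edge flipping coordinate $j$ has color $j$; the rainbow is the cyclic order of the colors. $\mathbf 1=(1,1,1,1,1)$. Vertices at even distance from $\mathbf 1$ are white, the others black. $v_j$ is the neighbor of $v$ along color $j$. $f_{j,j+1}(v)$ is the face center of the 4-cycle through $v$ with colors $j,j+1$; it depends only on the 4-cycle, so there are 8 face centers for each pair of adjacent colors. **Color splitting.** $S_{k,v}(u)=+$ if paths in $H^5$ from $v$ to $u$ use an even total number of edges of colors $k$ and $k+2$, and $-$ if odd (independent of the path). The total-color-splitting with starting vertex $v$ is $S_v(u)=(S_{1,v}(u),\dots,S_{5,v}(u))$. **Curve and embedded points.** $\phi=(1+\sqrt5)/2$, $\zeta=e^{2\pi i/10}$. $X^5_{\rm alg}\subset\mathbb{P}^4$ is given by $x_1^2+x_2^2+x_3^2=0$, $\phi x_1^2+x_2^2+x_4^2=0$, $(\phi+1)x_1^2+x_2^2+x_5^2=0$. The sign ${\rm sgn}_k(j)$ for $j=1,\dots,5$ is: $k=1$: $+,+,+,+,+$; $k=2$: $-,-,-,-,+$; $k=3$: $-,+,+,+,-$; $k=4$: $-,-,+,+,-$; $k=5$: $-,-,-,+,-$. The vertex $\mathbf 1$ is placed at $[1:\zeta^2\sqrt\phi:\zeta^9:i\zeta^6:\zeta^8\sqrt\phi]$, and the face centers at $\mathbf 1$ at: $f_{5,1}(\mathbf 1)=[1:0:-i:-i\sqrt\phi:-i\sqrt{\phi+1}]$,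 $f_{1,2}(\mathbf 1)=[1:i:0:-i\sqrt{\phi-1}:-i\sqrt\phi]$, $f_{2,3}(\mathbf 1)=[1:i\sqrt\phi:\sqrt{\phi-1}:0:-i]$, $f_{3,4}(\mathbf 1)=[1:i\sqrt{\phi+1}:\sqrt\phi:1:0]$, $f_{4,5}(\mathbf 1)=[0:1:-i:-i:-i]$. If $v$ (resp. $f_{m,m+1}(v)$) is placed at $[x_1:\dots:x_5]$, then $v_j$ (resp. $f_{m,m+1}(v_j)$) is placed at $[{\rm sgn}_1(j)\overline{x_1}:\dots:{\rm sgn}_5(j)\overline{x_5}]$; this determines all positions consistently. **Elliptic curves, fields and maps.** $E_1,E_4: y^2=x(x-1)(x-(\phi+1))$; $E_2,E_5: y^2=x(x-1)(x-\phi)$; $E_3: y^2=x(x-1)(x+\phi)$, with point at infinity $O_k$ as identity. $K_k=\mathbb{Q}(\zeta,i)$ for $k=1,3,4$ and $K_k=\mathbb{Q}(\zeta,i,\sqrt\phi)$ for $k=2,5$. The morphisms $\nu_k:X^5_{\rm alg}\to E_k$ are $\nu_1=\big(-(2\phi+1)\tfrac{x_1^2}{x_5^2}-\phi,\ (2\phi+1)\tfrac{x_2x_3x_4}{x_5^3}\big)$, $\nu_2=\big(\tfrac{x_2^2}{x_1^2}+\phi+1,\ i\tfrac{x_3x_4x_5}{x_1^3}\big)$, $\nu_3=\big((2\phi+1)\tfrac{x_3^2}{x_2^2}+\phi+1,\ i(2\phi+1)\tfrac{x_1x_4x_5}{x_2^3}\big)$, $\nu_4=\big((\phi+1)\tfrac{x_4^2}{x_3^2}-\phi,\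 i\phi\tfrac{x_1x_2x_5}{x_3^3}\big)$, $\nu_5=\big(-\tfrac{x_5^2}{x_4^2}+\phi+1,\ i\tfrac{x_1x_2x_3}{x_4^3}\big)$, where points with vanishing denominator go to $O_k$. *)

theory Defs
  imports
    "HOL-Analysis.Analysis"
    "HOL-Algebra.Elementary_Groups"
    "HOL-Algebra.Multiplicative_Group"
    "HOL-Algebra.Generated_Fields"
begin

text \<open>
  Colors are elements of the five-element type \<^typ>\<open>5\<close>, in which arithmetic is modulo 5 and
  \<open>5 = 0\<close>.  So the rainbow (1,2,3,4,5) is the cyclic order \<open>j \<mapsto> j + 1\<close>.
\<close>

lemma exhaust_5:
  fixes x :: 5
  shows "x = 1 \<or> x = 2 \<or> x = 3 \<or> x = 4 \<or> x = 5"
proof (induct x)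
  case (of_int z)
  then have "z = 0 \<or> z = 1 \<or> z = 2 \<or> z = 3 \<or> z = 4" by fastforce
  then show ?case by auto
qed

lemma forall_5: "(\<forall>i::5. P i) \<longleftrightarrow> P 1 \<and> P 2 \<and> P 3 \<and> P 4 \<and> P 5"
  by (metis exhaust_5)

lemma exists_5: "(\<exists>i::5. P i) \<longleftrightarrow> P 1 \<or> P 2 \<or> P 3 \<or> P 4 \<or> P 5"
  by (metis exhaust_5)

lemma vector_5:
  "(vector [a,b,c,d,e] :: 'a::zero ^ 5) $ 1 = a"
  "(vector [a,b,c,d,e] :: 'a::zero ^ 5) $ 2 = b"
  "(vector [a,b,c,d,e] :: 'a::zero ^ 5) $ 3 = c"
  "(vector [a,b,c,d,e] :: 'a::zero ^ 5) $ 4 = d"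
  "(vector [a,b,c,d,e] :: 'a::zero ^ 5) $ 5 = e"
  unfolding vector_def by simp_all


section \<open>The hypercube\<close>

type_synonym vertex = "5 \<Rightarrow> bool"

definition nbr :: "vertex \<Rightarrow> 5 \<Rightarrow> vertex"
  where "nbr v j = v(j := \<not> v j)"

abbreviation ones :: vertex
  where "ones \<equiv> (\<lambda>_. True)"

text \<open>
  A path is given by its initial vertex and the sequence of colors of its edges: at each vertex
  there is exactly one edge of each color.
\<close>
definition path_from_to :: "vertex \<Rightarrow> 5 list \<Rightarrow> vertex \<Rightarrow> bool"
  where "path_from_to v cs u \<longleftrightarrow> foldl nbr v cs = u"

definition hdist :: "vertex \<Rightarrow> vertex \<Rightarrow> nat"
  where "hdist v u = (LEAST n. \<exists>cs. path_from_to v cs u \<and> length cs = n)"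

definition white :: "vertex \<Rightarrow> bool"
  where "white u \<longleftrightarrow> even (hdist ones u)"

text \<open>
  \<open>color_splitting k v u\<close> is the sign (1 or -1) called $S_{k,v}(u)$.  Independence of the path is
  \<open>color_splitting_path\<close> below.
\<close>
definition color_splitting :: "5 \<Rightarrow> vertex \<Rightarrow> vertex \<Rightarrow> int"
  where "color_splitting k v u =
    (if \<forall>cs. path_from_to v cs u \<longrightarrow> even (length (filter (\<lambda>j. j = k \<or> j = k + 2) cs))
     then 1 else - 1)"

lemma path_parity:
  assumes "path_from_to v cs u"
  shows "even (length (filter (\<lambda>j. j = k \<or> j = k + 2) cs))
           \<longleftrightarrow> ((v k = u k) = (v (k + 2) = u (k + 2)))"
  using assms
proof (induction cs arbitrary: v)
  case Nil
  then show ?case by (auto simp: path_from_to_def)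
next
  case (Cons c cs)
  then have "path_from_to (nbr v c) cs u" by (simp add: path_from_to_def)
  from Cons.IH[OF this] show ?case
    by (auto simp: nbr_def)
qed

lemma path_exists: "\<exists>cs. path_from_to v cs u \<and> length cs = card {j. v j \<noteq> u j}"
proof (induction "card {j. v j \<noteq> u j}" arbitrary: v)
  case 0
  then have "v = u" by auto
  then show ?case by (intro exI[of _ "[]"]) (simp add: path_from_to_def)
next
  case (Suc n)
  then obtain j where j: "v j \<noteq> u j"
    by (metis (mono_tags, lifting) card.empty empty_Collect_eq nat.distinct(1))
  have "{i. v i \<noteq> u i} = insert j {i. nbr v j i \<noteq> u i}" "j \<notin> {i. nbr v j i \<noteq> u i}"
    using j by (auto simp: nbr_def)
  then have c: "card {i. v i \<noteq> u i} = Suc (card {i. nbr v j i \<noteq> u i})" by simp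
  with Suc obtain cs where "path_from_to (nbr v j) cs u" "length cs = card {i. nbr v j i \<noteq> u i}"
    by (metis nat.inject)
  with c show ?case by (intro exI[of _ "j # cs"]) (simp add: path_from_to_def)
qed

lemma color_splitting_path:
  assumes "path_from_to v cs u"
  shows "color_splitting k v u =
    (if even (length (filter (\<lambda>j. j = k \<or> j = k + 2) cs)) then 1 else - 1)"
  unfolding color_splitting_def
  using path_parity[OF assms, of k] path_parity[of v _ u k] assms by (auto split: if_splits)

lemma hdist_eq_card: "hdist v u = card {j. v j \<noteq> u j}"
  unfolding hdist_def
proof (rule Least_equality)
  show "\<exists>cs. path_from_to v cs u \<and> length cs = card {j. v j \<noteq> u j}"
    by (rule path_exists)
next
  fix n assume "\<exists>cs. path_from_to v cs u \<and> length cs = n"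
  then obtain cs where cs: "path_from_to v cs u" "length cs = n" by blast
  have "{j. v j \<noteq> u j} \<subseteq> set cs"
    using cs(1)
  proof (induction cs arbitrary: v)
    case Nil
    then show ?case by (simp add: path_from_to_def)
  next
    case (Cons c cs)
    then have "{j. nbr v c j \<noteq> u j} \<subseteq> set cs" by (simp add: path_from_to_def)
    then show ?case by (auto simp: nbr_def split: if_splits)
  qed
  then show "card {j. v j \<noteq> u j} \<le> n"
    using cs(2) by (metis List.finite_set card_length card_mono le_trans)
qed


section \<open>The curve in projective space\<close>

definition phi :: real
  where "phi = (1 + sqrt 5) / 2"

definition zeta :: complex
  where "zeta = exp (2 * of_real pi * \<i> / 10)"

abbreviation cphi :: complex
  where "cphi \<equiv> of_real phi"

abbreviation csq :: "real \<Rightarrow> complex"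
  where "csq r \<equiv> of_real (sqrt r)"

definition same_point :: "complex ^ 5 \<Rightarrow> complex ^ 5 \<Rightarrow> bool"
  where "same_point x y \<longleftrightarrow> x \<noteq> 0 \<and> (\<exists>c. c \<noteq> 0 \<and> y = c *s x)"

lemma same_point_refl_iff: "same_point x x \<longleftrightarrow> x \<noteq> 0"
  unfolding same_point_def by (auto intro: exI[of _ 1])

lemma part_equivp_same_point: "part_equivp same_point"
proof (rule part_equivpI)
  have "(vector [1,0,0,0,0] :: complex ^ 5) \<noteq> 0"
    by (metis vector_5(1) zero_index zero_neq_one)
  then show "\<exists>x. same_point x x" using same_point_refl_iff by blast
  show "symp same_point"
  proof (rule sympI)
    fix x y assume "same_point x y"
    then obtain c where c: "x \<noteq> 0" "c \<noteq> 0" "y = c *s x" by (auto simp: same_point_def)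
    then have "x = inverse c *s y" by (simp add: vector_smult_assoc)
    with c show "same_point y x" unfolding same_point_def
      by (metis nonzero_imp_inverse_nonzero vector_mul_eq_0)
  qed
  show "transp same_point"
  proof (rule transpI)
    fix x y z assume "same_point x y" "same_point y z"
    then obtain c d where "x \<noteq> 0" "c \<noteq> 0" "d \<noteq> 0" "z = d *s (c *s x)"
      by (auto simp: same_point_def)
    then show "same_point x z" unfolding same_point_def
      by (intro conjI exI[of _ "d * c"]) (simp_all add: vector_smult_assoc)
  qed
qed

quotient_type proj4 = "complex ^ 5" / partial: same_point
  by (rule part_equivp_same_point)

lift_definition on_X5 :: "proj4 \<Rightarrow> bool" is
  "\<lambda>x. (x$1)^2 + (x$2)^2 + (x$3)^2 = 0
     \<and> cphi * (x$1)^2 + (x$2)^2 + (x$4)^2 = 0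
     \<and> (cphi + 1) * (x$1)^2 + (x$2)^2 + (x$5)^2 = 0"
proof -
  fix x y :: "complex ^ 5"
  assume "same_point x y"
  then obtain c where c: "c \<noteq> 0" "y = c *s x" by (auto simp: same_point_def)
  have "r * (y$1)^2 + (y$2)^2 + (y$k)^2 = c^2 * (r * (x$1)^2 + (x$2)^2 + (x$k)^2)" for r k
    by (simp add: c power_mult_distrib algebra_simps)
  then have *: "r * (y$1)^2 + (y$2)^2 + (y$k)^2 = 0 \<longleftrightarrow> r * (x$1)^2 + (x$2)^2 + (x$k)^2 = 0" for r k
    using c by simp
  show "?thesis x y"
    using *[of 1 3] *[of cphi 4] *[of "cphi + 1" 5] by simp
qed

definition X5_alg :: "proj4 set"
  where "X5_alg = {p. on_X5 p}"

text \<open>\<open>color_sgn k j\<close> is $\mathrm{sgn}_k(j)$; the rows are k = 1,...,5.\<close>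
definition color_sgn :: "5 \<Rightarrow> 5 \<Rightarrow> complex"
  where "color_sgn k j = (vector
    [vector [ 1,  1,  1,  1,  1],
     vector [-1, -1, -1, -1,  1],
     vector [-1,  1,  1,  1, -1],
     vector [-1, -1,  1,  1, -1],
     vector [-1, -1, -1,  1, -1]] :: complex ^ 5 ^ 5) $ k $ j"

lemma color_sgn_square: "color_sgn k j * color_sgn k j = 1"
  and color_sgn_nonzero: "color_sgn k j \<noteq> 0"
  and cnj_color_sgn: "cnj (color_sgn k j) = color_sgn k j"
  using exhaust_5[of k] exhaust_5[of j] unfolding color_sgn_def
  by (auto simp: vector_5)

lift_definition reflect :: "5 \<Rightarrow> proj4 \<Rightarrow> proj4" is
  "\<lambda>j x. \<chi> k. color_sgn k j * cnj (x$k)"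
proof -
  fix j :: 5 and x y :: "complex ^ 5"
  assume "same_point x y"
  then obtain c where c: "x \<noteq> 0" "c \<noteq> 0" "y = c *s x" by (auto simp: same_point_def)
  then obtain i where "x $ i \<noteq> 0" by (metis vec_eq_iff zero_index)
  then have "(\<chi> k. color_sgn k j * cnj (x$k)) \<noteq> 0"
    by (auto simp: vec_eq_iff color_sgn_nonzero intro!: exI[of _ i])
  with c show "same_point (\<chi> k. color_sgn k j * cnj (x$k)) (\<chi> k. color_sgn k j * cnj (y$k))"
    unfolding same_point_def
    by (intro conjI exI[of _ "cnj c"]) (auto simp: vec_eq_iff algebra_simps)
qed

lemma same_point_selfI: "x $ i \<noteq> 0 \<Longrightarrow> same_point x x"
  by (metis same_point_refl_iff zero_index)

definition base_vertex_coords :: "complex ^ 5"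
  where "base_vertex_coords =
    vector [1, zeta^2 * csq phi, zeta^9, \<i> * zeta^6, zeta^8 * csq phi]"

lift_definition base_vertex :: proj4 is base_vertex_coords
  by (rule same_point_selfI[of _ 1]) (simp add: base_vertex_coords_def vector_5)

text \<open>\<open>base_face m\<close> is the position of $f_{m,m+1}(\mathbf 1)$.\<close>
definition base_face_coords :: "5 \<Rightarrow> complex ^ 5"
  where "base_face_coords m =
    (if m = 1 then vector [1, \<i>, 0, - \<i> * csq (phi - 1), - \<i> * csq phi]
     else if m = 2 then vector [1, \<i> * csq phi, csq (phi - 1), 0, - \<i>]
     else if m = 3 then vector [1, \<i> * csq (phi + 1), csq phi, 1, 0]
     else if m = 4 then vector [0, 1, - \<i>, - \<i>, - \<i>]
     else vector [1, 0, - \<i>, - \<i> * csq phi, - \<i> * csq (phi + 1)])"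

lift_definition base_face :: "5 \<Rightarrow> proj4" is base_face_coords
  subgoal for m
    by (rule same_point_selfI[of _ "if m = 4 then 2 else 1"])
      (simp add: base_face_coords_def vector_5)
  done

text \<open>
  Positions are obtained by reflecting along the colors in which a vertex differs from \<open>ones\<close>.
  The lemmas \<open>vertex_pos_nbr\<close>, \<open>face_pos_nbr\<close> and \<open>face_pos_cycle\<close> say that this is the
  consistent placement generated by the base points; \<open>face_pos m v\<close> is the position
  of $f_{m,m+1}(v)$.
\<close>
definition displacement :: "vertex \<Rightarrow> 5 list"
  where "displacement v = filter (\<lambda>j. \<not> v j) [1, 2, 3, 4, 5]"

definition vertex_pos :: "vertex \<Rightarrow> proj4"
  where "vertex_pos v = fold reflect (displacement v) base_vertex"

definition face_pos :: "5 \<Rightarrow> vertex \<Rightarrow> proj4"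
  where "face_pos m v = fold reflect (displacement v) (base_face m)"

lemma same_point_cong: "x \<noteq> 0 \<Longrightarrow> x = y \<Longrightarrow> same_point x y"
  using same_point_refl_iff by auto

lemma reflect_reflect: "reflect j (reflect j p) = p"
proof (transfer, rule same_point_cong)
  fix j :: 5 and x :: "complex ^ 5"
  have *: "(\<chi> k. color_sgn k j * cnj ((\<chi> k. color_sgn k j * cnj (x$k)) $ k)) = x"
    by (simp add: vec_eq_iff cnj_color_sgn color_sgn_square mult.assoc[symmetric])
  then show "(\<chi> k. color_sgn k j * cnj ((\<chi> k. color_sgn k j * cnj (x$k)) $ k)) = x" .
  assume "same_point x x"
  then show "(\<chi> k. color_sgn k j * cnj ((\<chi> k. color_sgn k j * cnj (x$k)) $ k)) \<noteq> 0"
    unfolding * by (simp add: same_point_refl_iff)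
qed

lemma reflect_commute: "reflect i (reflect j p) = reflect j (reflect i p)"
proof (transfer, rule same_point_cong)
  fix i j :: 5 and x :: "complex ^ 5"
  let ?r = "\<lambda>j x. (\<chi> k. color_sgn k j * cnj (x$k)) :: complex ^ 5"
  show "?r i (?r j x) = ?r j (?r i x)"
    by (simp add: vec_eq_iff cnj_color_sgn)
  assume "same_point x x"
  then obtain l where "x $ l \<noteq> 0" by (metis same_point_refl_iff vec_eq_iff zero_index)
  then show "?r i (?r j x) \<noteq> 0"
    by (auto simp: vec_eq_iff color_sgn_nonzero intro!: exI[of _ l])
qed

lemma fold_reflect_commute: "fold reflect js (reflect j p) = reflect j (fold reflect js p)"
proof (induction js arbitrary: p)
  case (Cons a js)
  show ?case by (simp add: Cons.IH[symmetric] reflect_commute[of j a])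
qed simp

lemma fold_reflect_nbr:
  assumes "distinct js"
  shows "fold reflect (filter (\<lambda>i. \<not> nbr v j i) js) p =
    (if j \<in> set js then reflect j (fold reflect (filter (\<lambda>i. \<not> v i) js) p)
     else fold reflect (filter (\<lambda>i. \<not> v i) js) p)"
  using assms
  by (induction js arbitrary: p)
    (auto simp: nbr_def fold_reflect_commute reflect_reflect reflect_commute)

lemma fold_displacement_nbr:
  "fold reflect (displacement (nbr v j)) p = reflect j (fold reflect (displacement v) p)"
proof -
  have "j \<in> set [1, 2, 3, 4, 5]" using exhaust_5[of j] by auto
  moreover have "distinct [1, 2, 3, 4, 5 :: 5]" by simp
  ultimately show ?thesis unfolding displacement_def by (simp only: fold_reflect_nbr if_True)
qed

lemma vertex_pos_ones: "vertex_pos ones = base_vertex"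
  and face_pos_ones: "face_pos m ones = base_face m"
  by (simp_all add: vertex_pos_def face_pos_def displacement_def)

lemma vertex_pos_nbr: "vertex_pos (nbr v j) = reflect j (vertex_pos v)"
  and face_pos_nbr: "face_pos m (nbr v j) = reflect j (face_pos m v)"
  by (simp_all add: vertex_pos_def face_pos_def fold_displacement_nbr)

lemma reflect_base_face:
  assumes "j = m \<or> j = m + 1"
  shows "reflect j (base_face m) = base_face m"
  using assms
proof transfer
  fix j m :: 5
  assume jm: "j = m \<or> j = m + 1"
  let ?c = "if m = 4 \<and> j = 4 then - 1 else 1 :: complex"
  have six: "(6 :: 5) = 1" by simp
  have n: "(\<chi> k. color_sgn k j * cnj (base_face_coords m $ k)) = ?c *s base_face_coords m"
    using jm exhaust_5[of m]
    by (elim disjE; hypsubst)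
      (simp_all add: vec_eq_iff forall_5 vector_5 color_sgn_def base_face_coords_def six)
  have "base_face_coords m \<noteq> 0"
    using base_face.rsp by (simp add: rel_fun_def same_point_refl_iff)
  then show "same_point (\<chi> k. color_sgn k j * cnj (base_face_coords m $ k)) (base_face_coords m)"
    unfolding n same_point_def
    by (intro conjI exI[of _ ?c]) (auto simp: vector_smult_assoc)
qed

lemma face_pos_cycle:
  "face_pos m (nbr v m) = face_pos m v"
  "face_pos m (nbr v (m + 1)) = face_pos m v"
  by (simp_all add: face_pos_nbr) 
     (simp_all add: face_pos_def fold_reflect_commute[symmetric] reflect_base_face)


lemma phi_square: "phi^2 = phi + 1"
  by (simp add: phi_def power2_eq_square field_simps)

lemma on_X5_reflect:
  assumes "on_X5 p"
  shows "on_X5 (reflect j p)"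
  using assms
proof transfer
  fix j :: 5 and x :: "complex ^ 5"
  assume *: "(x$1)^2 + (x$2)^2 + (x$3)^2 = 0
     \<and> cphi * (x$1)^2 + (x$2)^2 + (x$4)^2 = 0
     \<and> (cphi + 1) * (x$1)^2 + (x$2)^2 + (x$5)^2 = 0"
  let ?y = "(\<chi> k. color_sgn k j * cnj (x$k)) :: complex ^ 5"
  have sq: "(?y $ k)^2 = cnj ((x$k)^2)" for k
    using color_sgn_square[of k j] by (simp add: power_mult_distrib power2_eq_square)
  show "(?y$1)^2 + (?y$2)^2 + (?y$3)^2 = 0
     \<and> cphi * (?y$1)^2 + (?y$2)^2 + (?y$4)^2 = 0
     \<and> (cphi + 1) * (?y$1)^2 + (?y$2)^2 + (?y$5)^2 = 0"
    using *[THEN conjunct1, THEN arg_cong, of cnj]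
      *[THEN conjunct2, THEN conjunct1, THEN arg_cong, of cnj]
      *[THEN conjunct2, THEN conjunct2, THEN arg_cong, of cnj]
    unfolding sq by simp
qed

lemma phi_pos: "phi > 0"
  by (simp add: phi_def add_pos_pos)

lemma phi_gt_1: "phi > 1"
  by (simp add: phi_def)

lemma zeta_pow_5: "zeta^5 = - 1"
  unfolding zeta_def by (simp add: exp_of_nat_mult[symmetric])

lemma zeta_cyclotomic: "zeta^4 - zeta^3 + zeta^2 - zeta + 1 = 0"
  and cphi_zeta: "cphi = zeta - zeta^4"
proof -
  have z: "zeta = cis (pi / 5)"
    by (simp add: zeta_def cis_conv_exp mult.commute)
  have "sin (pi / 5) > 0" by (rule sin_gt_zero) auto
  then have ne: "zeta + 1 \<noteq> 0" by (auto simp: z complex_eq_iff)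
  have "(zeta + 1) * (zeta^4 - zeta^3 + zeta^2 - zeta + 1) = zeta^5 + 1"
    by (simp add: power_numeral_reduce algebra_simps)
  then show c: "zeta^4 - zeta^3 + zeta^2 - zeta + 1 = 0" using ne zeta_pow_5 by simp
  define t where "t = 2 * cos (pi / 5)"
  have "zeta * zeta^4 = - 1" using zeta_pow_5 by (simp add: power_numeral_reduce)
  moreover have "zeta * cnj zeta = 1" by (simp add: z cis_cnj cis_mult)
  ultimately have "zeta * (zeta^4 + cnj zeta) = 0" by (simp add: algebra_simps)
  moreover have "zeta \<noteq> 0" using zeta_pow_5 by auto
  ultimately have cz: "cnj zeta = - (zeta^4)" by (simp add: eq_neg_iff_add_eq_0 add.commute)
  have "zeta + cnj zeta = of_real t"
    by (simp add: complex_add_cnj z t_def)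
  then have t: "of_real t = zeta - zeta^4" by (simp add: cz)
  have "(zeta - zeta^4)^2 - (zeta - zeta^4) - 1
      = (zeta^4 - zeta^3 + zeta^2 - zeta + 1) * (zeta^4 + zeta^3 - 2 * zeta - 1)"
    by (simp add: power_numeral_reduce algebra_simps)
  then have "complex_of_real (t^2 - t - 1) = 0" unfolding c by (simp add: t)
  then have "t^2 - t - 1 = 0" by (simp only: of_real_eq_0_iff)
  then have "(t - phi) * (t + phi - 1) = 0"
    using phi_square by (simp add: power2_eq_square algebra_simps)
  moreover have "t \<ge> 0" unfolding t_def
    using pi_ge_zero by (intro mult_nonneg_nonneg cos_ge_zero) linarith+
  ultimately have "t = phi" using phi_gt_1 by auto
  with t show "cphi = zeta - zeta^4" by simp
qed

lemma on_X5_base_vertex: "on_X5 base_vertex"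
proof transfer
  have sq: "csq phi ^ 2 = zeta - zeta^4"
    using phi_pos by (simp flip: of_real_power cphi_zeta)
  define z where "z = zeta"
  have p: "z^5 = - 1" using zeta_pow_5 by (simp add: z_def)
  have c: "z^4 = z^3 - z^2 + z - 1"
    using zeta_cyclotomic unfolding z_def by (subst eq_iff_diff_eq_0) (simp add: algebra_simps)
  have p5: "z^(n + 5) = - (z^n)" for n by (simp add: power_add p)
  have r: "z^8 = - (z^3)" "z^12 = z^2" "z^6 = - z" "z^18 = - (z^3)"
    using p5[of 3] p5[of 7] p5[of 2] p5[of 1] p5[of 13] p5[of 8] by simp_all
  have "(z^2)^2 * (z - z^4) = z^5 - z^8" "(- z) * (z - z^4) = - (z^2) + z^5"
    by (simp_all add: power_numeral_reduce algebra_simps)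
  moreover have "(z^8)^2 = - z"
    unfolding r(1) using r(3) by (simp flip: power_mult)
  ultimately have "(z^2)^2 * (z - z^4) = z^3 - 1" "(z^8)^2 * (z - z^4) = - (z^2) - 1"
    unfolding p r by simp_all
  then have "1 + (zeta^2 * csq phi)^2 + (zeta^9)^2 = 0"
    "cphi + (zeta^2 * csq phi)^2 + (\<i> * zeta^6)^2 = 0"
    "(cphi + 1) + (zeta^2 * csq phi)^2 + (zeta^8 * csq phi)^2 = 0"
    unfolding power_mult_distrib sq cphi_zeta z_def[symmetric]
    using c r(2,4) by (simp_all flip: power_mult)
  then show "(base_vertex_coords $ 1)\<^sup>2 + (base_vertex_coords $ 2)\<^sup>2 + (base_vertex_coords $ 3)\<^sup>2 = 0 \<and>
    cphi * (base_vertex_coords $ 1)\<^sup>2 + (base_vertex_coords $ 2)\<^sup>2 + (base_vertex_coords $ 4)\<^sup>2 = 0 \<and>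
    (cphi + 1) * (base_vertex_coords $ 1)\<^sup>2 + (base_vertex_coords $ 2)\<^sup>2 + (base_vertex_coords $ 5)\<^sup>2 = 0"
    by (simp add: base_vertex_coords_def vector_5)
qed

lemma on_X5_base_face: "on_X5 (base_face m)"
proof transfer
  fix m :: 5
  have sq: "csq phi ^ 2 = cphi" "csq (phi - 1) ^ 2 = cphi - 1" "csq (phi + 1) ^ 2 = cphi + 1"
    using phi_gt_1 by (simp_all flip: of_real_power)
  have p: "cphi ^ 2 = cphi + 1"
    using phi_square by (metis of_real_1 of_real_add of_real_power)
  then have "cphi * cphi = cphi + 1" by (simp add: power2_eq_square)
  with p sq show "(base_face_coords m $ 1)\<^sup>2 + (base_face_coords m $ 2)\<^sup>2 + (base_face_coords m $ 3)\<^sup>2 = 0 \<and>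
    cphi * (base_face_coords m $ 1)\<^sup>2 + (base_face_coords m $ 2)\<^sup>2 + (base_face_coords m $ 4)\<^sup>2 = 0 \<and>
    (cphi + 1) * (base_face_coords m $ 1)\<^sup>2 + (base_face_coords m $ 2)\<^sup>2 + (base_face_coords m $ 5)\<^sup>2 = 0"
    by (simp add: base_face_coords_def vector_5 power_mult_distrib)
qed

lemma vertex_pos_in_X5: "vertex_pos v \<in> X5_alg"
  and face_pos_in_X5: "face_pos m v \<in> X5_alg"
proof -
  have "on_X5 (fold reflect js p)" if "on_X5 p" for js p
    using that by (induction js arbitrary: p) (simp_all add: on_X5_reflect)
  then show "vertex_pos v \<in> X5_alg" "face_pos m v \<in> X5_alg"
    by (simp_all add: X5_alg_def vertex_pos_def face_pos_def on_X5_base_vertex on_X5_base_face)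
qed


section \<open>Elliptic curves and their Mordell--Weil groups\<close>

text \<open>Points of $y^2 = x (x - 1) (x - \lambda)$, with the chord-and-tangent addition.\<close>

datatype ec_point = Infinity | Affine complex complex

fun ec_add :: "complex \<Rightarrow> ec_point \<Rightarrow> ec_point \<Rightarrow> ec_point" where
  "ec_add l Infinity Q = Q"
| "ec_add l P Infinity = P"
| "ec_add l (Affine x1 y1) (Affine x2 y2) =
    (if x1 = x2 \<and> y1 = - y2 then Infinity
     else let s = (if x1 = x2 then (3 * x1^2 - 2 * (1 + l) * x1 + l) / (2 * y1)
                   else (y2 - y1) / (x2 - x1));
              x3 = s^2 + (1 + l) - x1 - x2
          in Affine x3 (s * (x1 - x3) - y1))"

definition ec_points :: "complex \<Rightarrow> complex set \<Rightarrow> ec_point set"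
  where "ec_points l K =
    insert Infinity {Affine x y | x y. x \<in> K \<and> y \<in> K \<and> y^2 = x * (x - 1) * (x - l)}"

definition ec_group :: "complex \<Rightarrow> complex set \<Rightarrow> ec_point monoid"
  where "ec_group l K = \<lparr>carrier = ec_points l K, monoid.mult = ec_add l, one = Infinity\<rparr>"

definition curve_param :: "5 \<Rightarrow> complex"
  where "curve_param k =
    (if k = 1 \<or> k = 4 then cphi + 1 else if k = 2 \<or> k = 5 then cphi else - cphi)"

definition complex_ring :: "complex ring"
  where "complex_ring =
    \<lparr>carrier = UNIV, monoid.mult = (*), one = 1, ring.zero = 0, add = (+)\<rparr>"

definition adjoin_Q :: "complex set \<Rightarrow> complex set"
  where "adjoin_Q S = generate_field complex_ring S"

definition base_field :: "5 \<Rightarrow> complex set"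
  where "base_field k =
    (if k = 2 \<or> k = 5 then adjoin_Q {zeta, \<i>, csq phi} else adjoin_Q {zeta, \<i>})"

definition mordell_weil :: "5 \<Rightarrow> ec_point monoid"
  where "mordell_weil k = ec_group (curve_param k) (base_field k)"

definition affine_or_inf :: "complex \<Rightarrow> complex \<Rightarrow> complex \<Rightarrow> ec_point"
  where "affine_or_inf d x y = (if d = 0 then Infinity else Affine x y)"

text \<open>The maps are only meaningful on \<open>X5_alg\<close>, which contains all positions used here.\<close>
lift_definition nu :: "5 \<Rightarrow> proj4 \<Rightarrow> ec_point" is
  "\<lambda>k x.
    if k = 1 then affine_or_inf (x$5)
      (- (2 * cphi + 1) * ((x$1)^2 / (x$5)^2) - cphi)
      ((2 * cphi + 1) * (x$2 * x$3 * x$4 / (x$5)^3))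
    else if k = 2 then affine_or_inf (x$1)
      ((x$2)^2 / (x$1)^2 + cphi + 1)
      (\<i> * (x$3 * x$4 * x$5 / (x$1)^3))
    else if k = 3 then affine_or_inf (x$2)
      ((2 * cphi + 1) * ((x$3)^2 / (x$2)^2) + cphi + 1)
      (\<i> * (2 * cphi + 1) * (x$1 * x$4 * x$5 / (x$2)^3))
    else if k = 4 then affine_or_inf (x$3)
      ((cphi + 1) * ((x$4)^2 / (x$3)^2) - cphi)
      (\<i> * cphi * (x$1 * x$2 * x$5 / (x$3)^3))
    else affine_or_inf (x$4)
      (- ((x$5)^2 / (x$4)^2) + cphi + 1)
      (\<i> * (x$1 * x$2 * x$3 / (x$4)^3))"
proof -
  fix k :: 5 and x y :: "complex ^ 5"
  assume "same_point x y"
  then obtain c where c: "c \<noteq> 0" "y = c *s x" by (auto simp: same_point_def)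
  have q: "(y$i)^2 / (y$j)^2 = (x$i)^2 / (x$j)^2" for i j
    using c by (simp add: power_mult_distrib)
  have "y$i * y$j * y$l / (y$m)^3 = (c^3 * (x$i * x$j * x$l)) / (c^3 * (x$m)^3)" for i j l m
    using c by (simp add: power_mult_distrib power3_eq_cube mult_ac)
  then have t: "y$i * y$j * y$l / (y$m)^3 = x$i * x$j * x$l / (x$m)^3" for i j l m
    using c by simp
  have z: "affine_or_inf (y$i) = affine_or_inf (x$i)" for i
    using c by (simp add: affine_or_inf_def fun_eq_iff)
  show "?thesis k x y" by (simp only: q t z)
qed

end

theory Submission
  imports Defs "HOL-Computational_Algebra.Computational_Algebra" "HOL-Library.Set_Algebras"
begin

text \<open>
  Associativity of the chord-and-tangent law is obtained from ideal classes. Inside the field of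
  Laurent series in a uniformizer at infinity, let \<open>R\<close> be the coordinate ring of the affine curve and
  send a point \<open>(x, y)\<close> to the class of the ideal \<open>(X - x, Y - y)\<close>. Lines show that this map is additive;
  it is injective because no element of \<open>R\<close> has a simple pole at infinity.

  Every color reflection acts on \<open>E\<^sub>k\<close> as complex conjugation up to sign, so all vertices go to
  plus or minus the base vertex \<open>P\<close> or its conjugate, which is plus or minus \<open>P\<close> plus a 2-torsion point.
  The point \<open>P\<close> has infinite order: 2 is inert in \<open>\<int>[\<phi>]\<close>, the x-coordinate of \<open>2 P\<close> is an odd element
  of \<open>\<int>[\<phi>]\<close> divided by 4, and from there on each doubling multiplies the denominator by 4.
  \<open>P\<close>, a point of order 4 and a second 2-torsion point, both of them images of face centers,
  generate \<open>G\<^sub>k\<close>.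
\<close>

section \<open>Ideal classes and the chord-and-tangent law\<close>

text \<open>A direct check of associativity expands nested rational functions in many degenerate
  cases; for ideals it is inherited from multiplication, and only the geometry of lines remains.
  Laurent series are a convenient ambient field because the pole order at infinity is the negated
  subdegree. Polynomials in \<open>X\<close> have even order and nonzero polynomial multiples of
  \<open>Y\<close> odd order at least 3; this parity argument stands in for Riemann-Roch.

  The x-coordinate of \<open>P\<close> lies in \<open>\<rat>(zeta)\<close> but not in
  \<open>\<rat>(\<phi>)\<close>, whereas that of \<open>2 P\<close> does lie in
  \<open>\<rat>(\<phi>)\<close>. This is why the 2-adic argument starts after one doubling.

  An isomorphism of \<open>G\<^sub>k\<close> with the product is far from unique. Its first
  component, however, kills torsion and is onto, so it takes the value 1 or -1 on \<open>P\<close>.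
  The torsion by which conjugation moves \<open>P\<close> is therefore invisible in the projection;
  only signs survive, and counting them along a path from the base vertex produces the color
  splitting.\<close>

definition on_ec :: "complex \<Rightarrow> ec_point \<Rightarrow> bool" where
  "on_ec l P \<longleftrightarrow> (case P of Infinity \<Rightarrow> True | Affine x y \<Rightarrow> y^2 = x * (x - 1) * (x - l))"

lemma on_ec_simps [simp]:
  "on_ec l Infinity"
  "on_ec l (Affine x y) \<longleftrightarrow> y^2 = x * (x - 1) * (x - l)"
  by (simp_all add: on_ec_def)

fun ec_neg :: "ec_point \<Rightarrow> ec_point" where
  "ec_neg Infinity = Infinity"
| "ec_neg (Affine x y) = Affine x (- y)"

text \<open>The two expressions are the cubic and its derivative; a common zero would be a double
  root, but 0, 1 and \<open>l\<close> are distinct.\<close>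

lemma ec_smooth:
  fixes l x :: complex
  assumes "l \<noteq> 0" "l \<noteq> 1" "x * (x - 1) * (x - l) = 0" "3 * x^2 - 2 * (1 + l) * x + l = 0"
  shows False
proof -
  consider "x = 0" | "x = 1" | "x = l" using assms(3) by auto
  then show False
  proof cases
    case 3
    then have "l * (l - 1) = 0" using assms(4) by (simp add: power2_eq_square algebra_simps)
    then show False using assms by simp
  qed (use assms in \<open>simp_all add: algebra_simps\<close>)
qed

text \<open>The line \<open>Y = s X + d\<close> through two points that are not opposite meets the
  curve in three abscissas, and the last three equations are Vieta's formulas for them. They are the
  form in which chord and tangent addition enter the ideal computation.\<close>

lemma ec_add_affine:
  assumes c1: "on_ec l (Affine x1 y1)" and c2: "on_ec l (Affine x2 y2)"
    and ne: "\<not> (x1 = x2 \<and> y1 = - y2)"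
  obtains s d x3 where "y1 = s * x1 + d" "y2 = s * x2 + d"
    "ec_add l (Affine x1 y1) (Affine x2 y2) = Affine x3 (- (s * x3 + d))"
    "x1 + x2 + x3 = s^2 + 1 + l" "x1 * x2 + x1 * x3 + x2 * x3 = l - 2 * s * d" "x1 * x2 * x3 = d^2"
proof -
  define s where "s = (if x1 = x2 then (3 * x1^2 - 2 * (1 + l) * x1 + l) / (2 * y1)
                   else (y2 - y1) / (x2 - x1))"
  define d where "d = y1 - s * x1"
  define x3 where "x3 = s^2 + (1 + l) - x1 - x2"
  define p1 where "p1 = l - 2 * s * d - (x1 * x2 + x1 * x3 + x2 * x3)"
  define p0 where "p0 = d^2 - x1 * x2 * x3"
  have y1: "y1 = s * x1 + d" by (simp add: d_def)
  have eq: "x1 = x2 \<Longrightarrow> y1 = y2 \<and> y1 \<noteq> 0"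
  proof -
    assume x: "x1 = x2"
    then have "y1^2 = y2^2" using c1 c2 by simp
    then show "y1 = y2 \<and> y1 \<noteq> 0" using ne x by (auto simp: power2_eq_iff)
  qed
  have y2: "y2 = s * x2 + d"
  proof (cases "x1 = x2")
    case True
    with eq show ?thesis by (simp add: y1)
  next
    case False
    then have "s * (x2 - x1) = y2 - y1" by (simp add: s_def)
    then show ?thesis by (simp add: d_def algebra_simps)
  qed
  \<comment> \<open>The choice of \<open>x3\<close> cancels the quadratic term, so this difference
    is linear in \<open>z\<close>. It vanishes at \<open>x1\<close> and \<open>x2\<close>, or doubly
    at \<open>x1\<close> for a tangent, so both coefficients are 0.\<close>
  have p: "p1 * z - p0 = z * (z - 1) * (z - l) - (s * z + d)^2 - (z - x1) * (z - x2) * (z - x3)" for z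
    unfolding p1_def p0_def x3_def by (simp add: power2_eq_square algebra_simps)
  have r1: "p1 * x1 - p0 = 0" unfolding p y1[symmetric] using c1 by simp
  have "p1 = 0"
  proof (cases "x1 = x2")
    case True
    have "2 * y1 * s = 3 * x1^2 - 2 * (1 + l) * x1 + l"
      using True eq by (auto simp: s_def)
    then have "2 * (s * x1 + d) * s = 3 * x1^2 - 2 * (1 + l) * x1 + l" by (simp add: y1)
    then show ?thesis unfolding p1_def x3_def True[symmetric]
      by (simp add: power2_eq_square algebra_simps)
  next
    case False
    have "p1 * x2 - p0 = 0" unfolding p y2[symmetric] using c2 by simp
    with r1 have "p1 * (x1 - x2) = 0" by (simp add: algebra_simps)
    with False show ?thesis by simp
  qed
  with r1 have "p0 = 0" by simp
  have "ec_add l (Affine x1 y1) (Affine x2 y2) = Affine x3 (s * (x1 - x3) - y1)"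
    using ne by (simp only: ec_add.simps Let_def s_def[symmetric] x3_def[symmetric] if_False)
  then have "ec_add l (Affine x1 y1) (Affine x2 y2) = Affine x3 (- (s * x3 + d))"
    by (simp add: d_def algebra_simps)
  moreover have "x1 + x2 + x3 = s^2 + 1 + l" by (simp add: x3_def)
  moreover have "x1 * x2 + x1 * x3 + x2 * x3 = l - 2 * s * d" using \<open>p1 = 0\<close> by (simp add: p1_def)
  moreover have "x1 * x2 * x3 = d^2" using \<open>p0 = 0\<close> by (simp add: p0_def)
  ultimately show thesis by (rule that[OF y1 y2])
qed

text \<open>Pole orders at infinity are negated subdegrees, and the gap at -1 is the form in which
  genus one enters. The zero series has subdegree 0, so \<open>deg_R\<close> is consistent with
  \<open>0 \<in> R\<close>.\<close>

locale ec_function_ring =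
  fixes l :: complex and R :: "complex fls set" and X Y :: "complex fls"
  assumes l0: "l \<noteq> 0" and l1: "l \<noteq> 1"
    and const_R [simp, intro]: "fls_const c \<in> R"
    and X_R [simp, intro]: "X \<in> R" and Y_R [simp, intro]: "Y \<in> R"
    and add_R [simp, intro]: "a \<in> R \<Longrightarrow> b \<in> R \<Longrightarrow> a + b \<in> R"
    and mult_R [simp, intro]: "a \<in> R \<Longrightarrow> b \<in> R \<Longrightarrow> a * b \<in> R"
    and curve: "Y^2 = X * (X - 1) * (X - fls_const l)"
    and deg_X: "fls_subdegree X = -2" and deg_Y: "fls_subdegree Y = -3"
    and deg_R: "a \<in> R \<Longrightarrow> fls_subdegree a \<le> 0 \<and> fls_subdegree a \<noteq> -1"
begin

abbreviation C :: "complex \<Rightarrow> complex fls" where "C \<equiv> fls_const"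

lemmas C_hom = fls_plus_const[symmetric] fls_minus_const[symmetric] fls_const_mult_const[symmetric]
  fls_const_power fls_const_numeral fls_const_1 fls_const_uminus

section \<open>Fractional ideals of the coordinate ring and their classes\<close>

lemma one_R [simp, intro]: "1 \<in> R" using const_R[of 1] by simp
lemma zero_R [simp, intro]: "0 \<in> R" using const_R[of 0] by simp
lemma uminus_R [simp, intro]: "a \<in> R \<Longrightarrow> - a \<in> R" using mult_R[OF const_R[of "- 1"], of a] by simp
lemma diff_R [simp, intro]: "a \<in> R \<Longrightarrow> b \<in> R \<Longrightarrow> a - b \<in> R"
  using add_R[of a "- b"] by simp

text \<open>Generators may be arbitrary Laurent series, so this is a fractional ideal, an
  \<open>R\<close>-submodule of the field. The pointwise product \<open>S * T\<close> of generating
  sets generates the product ideal.\<close>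

inductive_set idl :: "complex fls set \<Rightarrow> complex fls set" for S where
  zero: "0 \<in> idl S"
| step: "x \<in> idl S \<Longrightarrow> r \<in> R \<Longrightarrow> s \<in> S \<Longrightarrow> x + r * s \<in> idl S"

lemma idl_base: "s \<in> S \<Longrightarrow> s \<in> idl S"
  using idl.step[OF idl.zero one_R, of s S] by simp

lemma idl_add:
  assumes "x \<in> idl S" "y \<in> idl S"
  shows "x + y \<in> idl S"
  using assms(2,1)
  by (induction y rule: idl.induct) (auto simp: add.assoc[symmetric] intro: idl.step)

lemma idl_mult:
  assumes "r \<in> R" "x \<in> idl S"
  shows "r * x \<in> idl S"
  using assms(2,1)
  by (induction x rule: idl.induct)
    (auto simp: distrib_left mult.assoc[symmetric] intro: idl.zero idl.step)

lemma idl_least: "S \<subseteq> idl T \<Longrightarrow> idl S \<subseteq> idl T"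
proof
  fix x assume S: "S \<subseteq> idl T" and "x \<in> idl S"
  from this(2) show "x \<in> idl T"
    by (induction x rule: idl.induct) (use S in \<open>auto intro: idl.zero idl_add idl_mult\<close>)
qed

text \<open>This makes the product of ideals independent of the chosen generators, so that it
  descends to classes.\<close>

lemma idl_times_subset: "S \<subseteq> idl T \<Longrightarrow> S * U \<subseteq> idl (T * U)"
proof
  fix z assume S: "S \<subseteq> idl T" and "z \<in> S * U"
  then obtain x u where z: "z = x * u" "x \<in> idl T" "u \<in> U" by (auto elim!: set_times_elim)
  from z(2) have "x * u \<in> idl (T * U)"
  proof (induction x rule: idl.induct)
    case (step x r s)
    then have "x * u + r * (s * u) \<in> idl (T * U)" using z(3) by (intro idl.step) auto
    then show ?case by (simp add: algebra_simps)
  qed (simp add: idl.zero)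
  then show "z \<in> idl (T * U)" by (simp add: z)
qed

lemma subset_idl: "S \<subseteq> idl S"
  by (auto intro: idl_base)

lemma idl_times_cong:
  assumes "idl S = idl T"
  shows "idl (S * U) = idl (T * U)"
  using assms subset_idl by (intro equalityI idl_least idl_times_subset) auto

text \<open>Equality of ideal classes. The factor ranges over all nonzero Laurent series instead of
  the fraction field of \<open>R\<close>; where it matters, in \<open>pt_gens_principal\<close>, it
  turns out to lie in \<open>R\<close>.\<close>

definition eqv :: "complex fls set \<Rightarrow> complex fls set \<Rightarrow> bool" (infix \<open>\<asymp>\<close> 50) where
  "S \<asymp> T \<longleftrightarrow> (\<exists>c. c \<noteq> 0 \<and> idl S = idl ({c} * T))"

lemma singleton_times: "{a} * {b} = {a * b :: complex fls}"
  by (auto simp: set_times_def)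

lemma one_times: "{1 :: complex fls} * S = S"
  by (auto simp: set_times_def)

lemma eqv_refl: "S \<asymp> S"
  unfolding eqv_def by (intro exI[of _ 1]) (simp add: one_times)

lemma eqv_sym: "S \<asymp> T \<Longrightarrow> T \<asymp> S"
proof -
  assume "S \<asymp> T"
  then obtain c where c: "c \<noteq> 0" "idl S = idl ({c} * T)" by (auto simp: eqv_def)
  from idl_times_cong[OF c(2), of "{inverse c}"]
  have "idl ({inverse c} * S) = idl (({inverse c} * {c}) * T)" by (simp add: mult_ac)
  also have "({inverse c} * {c}) * T = T" using c by (simp add: singleton_times one_times)
  finally show "T \<asymp> S" using c unfolding eqv_def by (intro exI[of _ "inverse c"]) auto
qed

lemma eqv_times: "S \<asymp> T \<Longrightarrow> S * U \<asymp> T * U"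
  unfolding eqv_def by (metis idl_times_cong mult.assoc)

lemma eqv_trans [trans]: "S \<asymp> T \<Longrightarrow> T \<asymp> U \<Longrightarrow> S \<asymp> U"
proof -
  assume "S \<asymp> T" "T \<asymp> U"
  then obtain c d where c: "c \<noteq> 0" "idl S = idl ({c} * T)" and d: "d \<noteq> 0" "idl T = idl ({d} * U)"
    by (auto simp: eqv_def)
  from idl_times_cong[OF d(2), of "{c}"] have "idl ({c} * T) = idl (({c} * {d}) * U)"
    by (simp add: mult_ac)
  with c d show "S \<asymp> U" unfolding eqv_def
    by (intro exI[of _ "c * d"]) (simp add: singleton_times)
qed

lemma eqv_times2: "S \<asymp> T \<Longrightarrow> U \<asymp> V \<Longrightarrow> S * U \<asymp> T * V"
  by (metis eqv_times eqv_trans mult.commute)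

lemma idl_eqv: "idl S = idl T \<Longrightarrow> S \<asymp> T"
  unfolding eqv_def by (intro exI[of _ 1]) (simp add: one_times)

lemma singleton_eqv: "c \<noteq> 0 \<Longrightarrow> {c} \<asymp> {1}"
  unfolding eqv_def by (intro exI[of _ c]) (simp add: singleton_times)

text \<open>For a point of the affine curve this is its maximal ideal. Infinity is not on the affine
  curve and gets the unit ideal, hence the neutral class.\<close>

fun pt_gens :: "ec_point \<Rightarrow> complex fls set" where
  "pt_gens Infinity = {1}"
| "pt_gens (Affine x y) = {X - C x, Y - C y}"

lemma X_ne: "X - C x \<noteq> 0"
  using deg_X by auto

lemma deg_X_const: "fls_subdegree (X - C x) = -2"
proof -
  have "X \<noteq> 0" using deg_X by auto
  then show ?thesis
    using fls_subdegree_diff_eq1[of X "C x"] deg_X by simp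
qed

lemma deg_Y_const: "fls_subdegree (Y - C y) = -3"
proof -
  have "Y \<noteq> 0" using deg_Y by auto
  then show ?thesis
    using fls_subdegree_diff_eq1[of Y "C y"] deg_Y by simp
qed

lemma idl_singleton: "x \<in> idl {s} \<Longrightarrow> \<exists>r\<in>R. x = r * s"
proof (induction x rule: idl.induct)
  case zero
  then show ?case by (intro bexI[of _ 0]) auto
next
  case (step x r s')
  then obtain q where "q \<in> R" "x = q * s" by auto
  with step show ?case by (intro bexI[of _ "q + r"]) (auto simp: algebra_simps)
qed

text \<open>The vertical line through a point meets the curve in it and its negative. To recover
  \<open>X - x\<close> from the product, a nonzero constant multiple of it is produced: the constant
  is \<open>2 * y\<close> in general, and at a 2-torsion point the derivative of the cubic, nonzero
  by smoothness.\<close>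

lemma idl_pt_gens_neg:
  assumes yy: "y^2 = x * (x - 1) * (x - l)"
  shows "idl (pt_gens (Affine x y) * pt_gens (Affine x (- y))) = idl {X - C x}"
proof -
  let ?u = "X - C x" and ?v = "Y - C y" and ?w = "Y + C y"
  \<comment> \<open>Taylor expansion of the cubic at \<open>x\<close>: the cubic minus its value
    there is \<open>(X - x) * ((X - x) * q + e)\<close>, with \<open>e\<close> the first
    derivative.\<close>
  define e where "e = 3 * x^2 - 2 * (1 + l) * x + l"
  define q where "q = X + C (2 * x - (1 + l))"
  let ?g = "?u * q + C e"
  have CC: "C y ^2 = C x * (C x - 1) * (C x - C l)"
    using arg_cong[OF yy, of C] by (simp only: C_hom)
  have "?v * ?w = X * (X - 1) * (X - C l) - C y ^ 2"
    unfolding curve[symmetric] by (simp add: power2_eq_square algebra_simps)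
  also have "\<dots> = ?u * ?g" unfolding CC q_def e_def C_hom
    by (simp add: power2_eq_square algebra_simps del: fls_const_mult_const)
  finally have vw: "?v * ?w = ?u * ?g" .
  have gens: "pt_gens (Affine x y) * pt_gens (Affine x (- y)) = {?u * ?u, ?u * ?w, ?v * ?u, ?v * ?w}" (is "_ = ?S")
    by (auto simp: set_times_def)
  have q_R: "q \<in> R" unfolding q_def by simp
  then have g_R: "?g \<in> R" by simp
  have "?S \<subseteq> idl {?u}"
  proof -
    have "r * ?u \<in> idl {?u}" if "r \<in> R" for r using that idl_base idl_mult by blast
    from this[of ?u] this[of ?w] this[of ?v] this[of ?g] g_R show ?thesis unfolding vw
      by (simp add: mult.commute)
  qed
  moreover have "?u \<in> idl ?S"
  proof (cases "y = 0")
    case False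
    have "?u * ?w + (- 1) * (?v * ?u) \<in> idl ?S"
      by (intro idl_add idl_mult idl_base) auto
    then have "C (inverse (2 * y)) * (?u * ?w + (- 1) * (?v * ?u)) \<in> idl ?S"
      by (intro idl_mult) auto
    also have "?u * ?w + (- 1) * (?v * ?u) = C (2 * y) * ?u"
      unfolding C_hom
    by (simp add: power2_eq_square algebra_simps del: fls_const_mult_const)
    also have "C (inverse (2 * y)) * (C (2 * y) * ?u) = ?u"
      using False by (simp add: mult.assoc[symmetric])
    finally show ?thesis .
  next
    case True
    have e: "e \<noteq> 0" using ec_smooth[OF l0 l1, of x] yy True unfolding e_def by auto
    have "?v * ?w + (- q) * (?u * ?u) \<in> idl ?S"
      using q_R by (intro idl_add idl_mult idl_base) auto
    also have "?v * ?w + (- q) * (?u * ?u) = C e * ?u"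
      unfolding vw by (simp add: algebra_simps)
    finally have "C e * ?u \<in> idl ?S" .
    then have "C (inverse e) * (C e * ?u) \<in> idl ?S" by (rule idl_mult[OF const_R])
    also have "C (inverse e) * (C e * ?u) = ?u"
      using e by (simp add: mult.assoc[symmetric])
    finally show ?thesis .
  qed
  ultimately show ?thesis unfolding gens by (intro equalityI idl_least) auto
qed

lemma pt_gens_neg:
  assumes "on_ec l P"
  shows "pt_gens P * pt_gens (ec_neg P) \<asymp> {1}"
proof (cases P)
  case Infinity
  then show ?thesis by (simp add: singleton_times eqv_refl)
next
  case (Affine x y)
  then show ?thesis
    using idl_eqv[OF idl_pt_gens_neg[of y x]] singleton_eqv[OF X_ne] eqv_trans assms
    by (simp del: pt_gens.simps)
qed

text \<open>A generator \<open>c\<close> of the ideal of an affine point divides functions of pole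
  order 2 and 3. Orders are nonnegative and never 1, so \<open>c\<close> has order 0. Then
  \<open>c * (Y + y) / (X - x)\<close> lies in \<open>R\<close> with pole order 1, which is
  impossible.\<close>

lemma pt_gens_principal:
  assumes "on_ec l T" "pt_gens T \<asymp> {1}"
  shows "T = Infinity"
proof (cases T)
  case (Affine x y)
  let ?u = "X - C x"
  obtain c where c: "c \<noteq> 0" "idl (pt_gens T) = idl {c}"
    using assms(2) by (auto simp: eqv_def singleton_times)
  have "c \<in> idl {c}" by (rule idl_base) simp
  then have "c \<in> idl (pt_gens T)" using c by simp
  moreover have "idl (pt_gens T) \<subseteq> R"
  proof
    fix z assume "z \<in> idl (pt_gens T)"
    then show "z \<in> R" by (induction z rule: idl.induct) (auto simp: Affine)
  qed
  ultimately have cR: "c \<in> R" by blast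
  have "?u \<in> idl {c}" "Y - C y \<in> idl {c}"
    unfolding c(2)[symmetric] by (auto simp: Affine intro: idl_base)
  then obtain a b where ab: "a \<in> R" "?u = a * c" "b \<in> R" "Y - C y = b * c"
    using idl_singleton by metis
  then have nz: "a \<noteq> 0" "b \<noteq> 0" using X_ne[of x] deg_Y_const[of y] by auto
  have da: "fls_subdegree a + fls_subdegree c = -2"
    using deg_X_const[of x] ab nz c by simp
  have db: "fls_subdegree b + fls_subdegree c = -3"
    using deg_Y_const[of y] ab nz c by simp
  have dc: "fls_subdegree c = 0"
    using da db deg_R[OF cR] deg_R[OF ab(1)] deg_R[OF ab(3)] by linarith
  \<comment> \<open>Multiplying (T) = (c) by the ideal of -T gives (X - x) = c * I(-T), and Y + y lies in I(-T).\<close>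
  let ?N = "pt_gens (ec_neg T)"
  have "c * (Y - C (- y)) \<in> {c} * ?N" by (rule set_times_intro) (auto simp: Affine)
  then have "c * (Y + C y) \<in> idl ({c} * ?N)" using subset_idl by auto
  also have "idl ({c} * ?N) = idl {?u}"
    using idl_times_cong[OF c(2), of ?N] idl_pt_gens_neg[of y x] assms(1) by (simp add: Affine)
  finally obtain e where e: "e \<in> R" "c * (Y + C y) = e * ?u" using idl_singleton by blast
  have "fls_subdegree (Y + C y) = -3" using deg_Y_const[of "- y"] by simp
  moreover from this have "Y + C y \<noteq> 0" by auto
  moreover from this have "e \<noteq> 0" using e(2) c by auto
  ultimately have "fls_subdegree e = -1"
    using arg_cong[OF e(2), of fls_subdegree] c X_ne[of x] dc deg_X_const[of x] by simp
  then show ?thesis using deg_R[OF e(1)] by simp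
qed simp

text \<open>The cubic is the square of the line function plus \<open>(X - x)^2 * (X - z)\<close>. If
  the line vanished at \<open>x\<close>, the cubic would have a double root there.\<close>

lemma double_root_ne:
  assumes "x + x + z = s^2 + 1 + l" "x * x + x * z + x * z = l - 2 * s * d" "x * x * z = d^2"
  shows "s * x + d \<noteq> 0"
proof
  assume d: "s * x + d = 0"
  have z: "z = s^2 + 1 + l - 2 * x" using assms(1) by (simp add: algebra_simps)
  have d: "d = - s * x" using d by (simp add: add_eq_0_iff)
  have f': "3 * x^2 - 2 * (1 + l) * x + l = 0"
    using assms(2) unfolding z d by (simp add: power2_eq_square algebra_simps)
  have "x * (x - 1) * (x - l) = x * (3 * x^2 - 2 * (1 + l) * x + l) + (x * x * z - d^2)"
    unfolding z d by (simp add: power2_eq_square algebra_simps)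
  then have "x * (x - 1) * (x - l) = 0" by (simp only: f' assms(3)) simp
  with f' show False using ec_smooth[OF l0 l1] by blast
qed

text \<open>Modulo \<open>X - x\<close> the line function is the nonzero constant
  \<open>s * x + d\<close>. This puts first \<open>X - x\<close> and then the square of that
  constant into \<open>J\<close>.\<close>

lemma unit_of_double_root:
  assumes add: "\<And>a b. a \<in> J \<Longrightarrow> b \<in> J \<Longrightarrow> a + b \<in> J"
    and mult: "\<And>a b. a \<in> R \<Longrightarrow> b \<in> J \<Longrightarrow> a * b \<in> J"
    and uu: "(X - C x) * (X - C x) \<in> J"
    and mu: "(C s * X + C d) * (X - C x) \<in> J"
    and mm: "(C s * X + C d) * (C s * X + C d) \<in> J"
    and ne: "s * x + d \<noteq> 0"
  shows "1 \<in> J"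
proof -
  let ?u = "X - C x"
  define m where "m = s * x + d"
  have "(C s * X + C d) * ?u + (- C s) * (?u * ?u) \<in> J"
    by (intro add mult uu mu) auto
  also have "(C s * X + C d) * ?u + (- C s) * (?u * ?u) = C m * ?u"
    unfolding m_def C_hom by (simp add: power2_eq_square algebra_simps del: fls_const_mult_const)
  finally have "C (inverse m) * (C m * ?u) \<in> J" by (rule mult[OF const_R])
  then have u: "?u \<in> J" using ne by (simp add: mult.assoc[symmetric] m_def)
  have "(C s * X + C d) * (C s * X + C d) + (- (C s * X + C d + C m) * C s) * ?u \<in> J"
    by (intro add mult mm u) auto
  also have "(C s * X + C d) * (C s * X + C d) + (- (C s * X + C d + C m) * C s) * ?u = C (m * m)"
    unfolding m_def C_hom by (simp add: power2_eq_square algebra_simps del: fls_const_mult_const)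
  finally have "C (inverse (m * m)) * C (m * m) \<in> J" by (rule mult[OF const_R])
  moreover have "inverse (m * m) * (m * m) = 1" using ne by (intro left_inverse) (simp add: m_def)
  ultimately show ?thesis by (simp only: fls_const_mult_const fls_const_1)
qed

text \<open>The product of the ideals of three collinear points is generated by the line function
  \<open>L\<close>. One inclusion rests on \<open>L' * L = u1 * u2 * u3\<close>; for the other,
  \<open>L\<close> is divided out and 1 has to be found in what remains. Distinct abscissas give
  this by nonzero constant differences, a repeated one by the tangent case above.\<close>

lemma pt_gens_line:
  assumes e1: "x1 + x2 + x3 = s^2 + 1 + l"
    and e2: "x1 * x2 + x1 * x3 + x2 * x3 = l - 2 * s * d" and e3: "x1 * x2 * x3 = d^2"
  shows "pt_gens (Affine x1 (s * x1 + d)) * pt_gens (Affine x2 (s * x2 + d))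
    * pt_gens (Affine x3 (s * x3 + d)) \<asymp> {1}"
proof -
  define M where "M = C s * X + C d"
  define L where "L = Y - M"
  define L' where "L' = Y + M"
  have M_R: "M \<in> R" and L_R: "L \<in> R" and L'_R: "L' \<in> R" by (auto simp: M_def L_def L'_def)
  \<comment> \<open>Replacing \<open>Y - y\<close> by \<open>L\<close> changes the second generator
    by a multiple of \<open>X - x\<close>, so all three ideals share the generator
    \<open>L\<close>.\<close>
  have pt: "idl (pt_gens (Affine x (s * x + d))) = idl {X - C x, L}" for x
  proof (intro equalityI idl_least)
    have "L + C s * (X - C x) \<in> idl {X - C x, L}"
      by (intro idl_add idl_mult idl_base) auto
    moreover have "Y - C (s * x + d) = L + C s * (X - C x)"
      unfolding L_def M_def C_hom by (simp add: algebra_simps del: fls_const_mult_const)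
    ultimately show "pt_gens (Affine x (s * x + d)) \<subseteq> idl {X - C x, L}"
      by (auto intro: idl_base)
    have "(Y - C (s * x + d)) + (- C s) * (X - C x) \<in> idl (pt_gens (Affine x (s * x + d)))"
      by (intro idl_add idl_mult idl_base) auto
    moreover have "(Y - C (s * x + d)) + (- C s) * (X - C x) = L"
      unfolding L_def M_def C_hom by (simp add: algebra_simps del: fls_const_mult_const)
    ultimately show "{X - C x, L} \<subseteq> idl (pt_gens (Affine x (s * x + d)))"
      by (auto intro: idl_base)
  qed
  define u1 where "u1 = X - C x1"
  define u2 where "u2 = X - C x2"
  define u3 where "u3 = X - C x3"
  note u_defs = u1_def u2_def u3_def
  have u_R: "u1 \<in> R" "u2 \<in> R" "u3 \<in> R" by (auto simp: u_defs)
  have "C x1 + C x2 + C x3 = C s^2 + 1 + C l"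
    using arg_cong[OF e1, of C] by (simp only: C_hom)
  then have x3: "C x3 = C s^2 + 1 + C l - C x1 - C x2" by (simp add: algebra_simps)
  have e2': "C x1 * C x2 + C x1 * C x3 + C x2 * C x3 = C l - 2 * C s * C d"
    using arg_cong[OF e2, of C] by (simp only: C_hom)
  have e3': "C x1 * C x2 * C x3 = C d^2"
    using arg_cong[OF e3, of C] by (simp only: C_hom)
  have "L' * L = X * (X - 1) * (X - C l) - M^2"
    unfolding curve[symmetric] L_def L'_def by (simp add: power2_eq_square algebra_simps)
  also have "\<dots> = X^3 - (C s^2 + 1 + C l) * X^2 + (C l - 2 * C s * C d) * X - C d^2"
    unfolding M_def
    by (simp add: power2_eq_square power3_eq_cube algebra_simps del: fls_const_mult_const)
  also have "\<dots> = u1 * u2 * u3"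
    unfolding e2'[symmetric] e3'[symmetric] x3[symmetric] u_defs
    unfolding x3
    by (simp add: power2_eq_square power3_eq_cube algebra_simps del: fls_const_mult_const)
  finally have L'L: "L' * L = u1 * u2 * u3" .
  let ?S = "{u1, L} * {u2, L} * {u3, L}"
  have S: "?S = {u1 * u2 * u3, u1 * u2 * L, u1 * L * u3, u1 * L * L,
      L * u2 * u3, L * u2 * L, L * L * u3, L * L * L}"
    by (auto simp: set_times_def mult.assoc; blast)
  \<comment> \<open>J is the colon ideal of L; smoothness of the curve makes it the unit ideal.\<close>
  define J where "J = {r. r * L \<in> idl ?S}"
  have add: "a \<in> J \<Longrightarrow> b \<in> J \<Longrightarrow> a + b \<in> J" for a b
    by (simp add: J_def distrib_right idl_add)
  have mult: "a \<in> R \<Longrightarrow> b \<in> J \<Longrightarrow> a * b \<in> J" for a b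
    by (simp add: J_def mult.assoc idl_mult)
  have b: "r \<in> J" if "t \<in> ?S" "r * L = t" for r t
    using that by (simp add: J_def idl_base)
  note b = b[unfolded S]
  have JL': "L' \<in> J" and JLL: "L * L \<in> J"
    and JLu: "L * u1 \<in> J" "L * u2 \<in> J" "L * u3 \<in> J"
    and Juu: "u1 * u2 \<in> J" "u1 * u3 \<in> J" "u2 * u3 \<in> J"
    by (rule b[of "u1 * u2 * u3"] b[of "L * L * L"] b[of "u1 * L * L"] b[of "L * u2 * L"]
        b[of "L * L * u3"] b[of "u1 * u2 * L"] b[of "u1 * L * u3"] b[of "L * u2 * u3"];
        simp add: L'L; fail)+
  \<comment> \<open>From \<open>2 M = L' - L\<close> and \<open>4 M^2 = (L' - L)^2\<close>, products
    with \<open>M\<close> are traded for products with \<open>L\<close> and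
    \<open>L'\<close>.\<close>
  have JMu: "M * u \<in> J" if "L * u \<in> J" "u \<in> R" for u
  proof -
    have "C (1/2) * (u * L' + (- 1) * (L * u)) \<in> J"
      by (rule mult[OF const_R add[OF mult[OF that(2) JL'] mult[OF uminus_R[OF one_R] that(1)]]])
    also have "u * L' + (- 1) * (L * u) = C 2 * (M * u)"
      by (simp add: L_def L'_def algebra_simps)
    also have "C (1/2) * (C 2 * (M * u)) = M * u"
      unfolding mult.assoc[symmetric] fls_const_mult_const by simp
    finally show ?thesis .
  qed
  have JMM: "M * M \<in> J"
  proof -
    have "C (1/4) * ((L' - C 2 * L) * L' + L * L) \<in> J"
      by (rule mult[OF const_R add[OF mult[OF _ JL'] JLL]]) (intro diff_R mult_R const_R L_R L'_R)
    also have "(L' - C 2 * L) * L' + L * L = C 4 * (M * M)"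
      by (simp add: L_def L'_def algebra_simps)
    also have "C (1/4) * (C 4 * (M * M)) = M * M"
      unfolding mult.assoc[symmetric] fls_const_mult_const by simp
    finally show ?thesis .
  qed
  have "1 \<in> J"
  proof (cases "x1 = x2 \<or> x1 = x3 \<or> x2 = x3")
    case True
    then consider "x1 = x2" | "x1 = x3" | "x2 = x3" by blast
    then show ?thesis
    proof cases
      case 1
      with Juu JMu[OF JLu(1) u_R(1)] JMM double_root_ne[of x1 x3 s d] e1 e2 e3 show ?thesis
        by (intro unit_of_double_root[OF add mult, of x1 s d]) (simp_all add: u_defs M_def)
    next
      case 2
      with Juu JMu[OF JLu(1) u_R(1)] JMM double_root_ne[of x1 x2 s d] e1 e2 e3 show ?thesis
        by (intro unit_of_double_root[OF add mult, of x1 s d])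
          (simp_all add: u_defs M_def ac_simps)
    next
      case 3
      with Juu JMu[OF JLu(2) u_R(2)] JMM double_root_ne[of x2 x1 s d] e1 e2 e3 show ?thesis
        by (intro unit_of_double_root[OF add mult, of x2 s d])
          (simp_all add: u_defs M_def ac_simps)
    qed
  next
    case False
    \<comment> \<open>Here \<open>a\<close> and \<open>c\<close> differ by a nonzero constant, so
      they are coprime and can be cancelled.\<close>
    have sub: "b \<in> J" if "a * b \<in> J" "c * b \<in> J" "a - c = C e" "e \<noteq> 0" for a b c e
    proof -
      have "C (inverse e) * (a * b + (- 1) * (c * b)) \<in> J"
        by (rule mult[OF const_R add[OF that(1) mult[OF uminus_R[OF one_R] that(2)]]])
      also have "a * b + (- 1) * (c * b) = C e * b"
        unfolding that(3)[symmetric] by (simp add: algebra_simps)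
      finally show "b \<in> J" using that(4) by (simp add: mult.assoc[symmetric])
    qed
    have "u1 \<in> J"
      by (rule sub[of u2 _ u3 "x3 - x2"])
        (use Juu False in \<open>auto simp: mult.commute u_defs fls_minus_const[symmetric]\<close>)
    moreover have "u2 \<in> J"
      by (rule sub[of u1 _ u3 "x3 - x1"])
        (use Juu False in \<open>auto simp: mult.commute u_defs fls_minus_const[symmetric]\<close>)
    ultimately have "u1 * 1 \<in> J" "u2 * 1 \<in> J" by simp_all
    then show ?thesis
      by (rule sub[of u1 1 u2 "x2 - x1"])
        (use False in \<open>auto simp: u_defs fls_minus_const[symmetric]\<close>)
  qed
  then have "L \<in> idl ?S" by (simp add: J_def)
  moreover have "?S \<subseteq> idl {L}"
  proof -
    have *: "r * L \<in> idl {L}" if "r \<in> R" for r using that idl_base idl_mult by blast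
    show ?thesis unfolding S L'L[symmetric]
      using *[of "L'"] *[of "u1 * u2"] *[of "u1 * u3"] *[of "u1 * L"] *[of "u2 * u3"]
        *[of "u2 * L"] *[of "u3 * L"] *[of "L * L"] u_R L_R L'_R
      by (simp add: mult_ac)
  qed
  ultimately have SL: "idl ?S = idl {L}" by (intro equalityI idl_least) auto
  have "L \<noteq> 0"
  proof
    assume "L = 0"
    then have "Y = C s * X + C d" by (simp add: L_def M_def)
    moreover have "X \<noteq> 0" using deg_X by auto
    then have "fls_subdegree (C s * X + C d) \<ge> -2"
      using fls_plus_subdegree[of "C s * X" "C d"] deg_X
      by (cases "s = 0"; cases "C s * X + C d = 0") auto
    ultimately show False using deg_Y by simp
  qed
  have "pt_gens (Affine x1 (s * x1 + d)) * pt_gens (Affine x2 (s * x2 + d))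
    * pt_gens (Affine x3 (s * x3 + d)) \<asymp> ?S"
    by (intro eqv_times2 idl_eqv) (simp_all only: pt u_defs)
  also have "?S \<asymp> {L}" using SL by (rule idl_eqv)
  also have "{L} \<asymp> {1}" using \<open>L \<noteq> 0\<close> by (rule singleton_eqv)
  finally show ?thesis .
qed

text \<open>With \<open>N\<close> the third point on the line, the ideals of \<open>P\<close>,
  \<open>Q\<close>, \<open>N\<close> multiply to a principal one, and so do those of
  \<open>N\<close> and \<open>P + Q = - N\<close>. Cancelling the class of \<open>N\<close> leaves
  the claim.\<close>

lemma pt_gens_add:
  assumes P: "on_ec l P" and Q: "on_ec l Q" and S: "on_ec l (ec_add l P Q)"
  shows "pt_gens (ec_add l P Q) \<asymp> pt_gens P * pt_gens Q"
proof (cases P)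
  case Infinity
  then show ?thesis by (simp add: one_times eqv_refl)
next
  case (Affine x1 y1)
  note P' = this
  show ?thesis
  proof (cases Q)
    case Infinity
    then show ?thesis by (simp add: P' one_times mult.commute[of _ "{1}"] eqv_refl)
  next
    case (Affine x2 y2)
    show ?thesis
    proof (cases "x1 = x2 \<and> y1 = - y2")
      case True
      then show ?thesis using pt_gens_neg[OF Q]
        by (simp add: P' Affine eqv_sym mult.commute)
    next
      case False
      obtain s d x3 where y: "y1 = s * x1 + d" "y2 = s * x2 + d"
        and add: "ec_add l P Q = Affine x3 (- (s * x3 + d))"
        and v: "x1 + x2 + x3 = s^2 + 1 + l"
          "x1 * x2 + x1 * x3 + x2 * x3 = l - 2 * s * d" "x1 * x2 * x3 = d^2"
        using ec_add_affine[OF P[unfolded P'] Q[unfolded Affine] False] P' Affine by metis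
      let ?S = "pt_gens (ec_add l P Q)" and ?N = "pt_gens (Affine x3 (s * x3 + d))"
      have line: "pt_gens P * pt_gens Q * ?N \<asymp> {1}"
        using pt_gens_line[OF v] unfolding y[symmetric] P'[symmetric] Affine[symmetric] .
      have "?S * ?N \<asymp> {1}" using pt_gens_neg[OF S] by (simp only: add ec_neg.simps minus_minus)
      have "?S = {1} * ?S" by (simp only: one_times)
      also have "\<dots> \<asymp> pt_gens P * pt_gens Q * ?N * ?S"
        by (intro eqv_times2 eqv_sym[OF line] eqv_refl)
      also have "pt_gens P * pt_gens Q * ?N * ?S = ?S * ?N * (pt_gens P * pt_gens Q)"
        by (simp only: mult_ac)
      also have "\<dots> \<asymp> {1} * (pt_gens P * pt_gens Q)"
        by (intro eqv_times2 \<open>?S * ?N \<asymp> {1}\<close> eqv_refl)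
      also have "\<dots> = pt_gens P * pt_gens Q" by (simp only: one_times)
      finally show ?thesis .
    qed
  qed
qed

end

section \<open>The chord-and-tangent law on points: closure, commutativity, associativity\<close>

lemma ec_neg_neg [simp]: "ec_neg (ec_neg P) = P"
  by (cases P) auto

lemma on_ec_neg [simp]: "on_ec l (ec_neg P) \<longleftrightarrow> on_ec l P"
  by (cases P) auto

lemma ec_add_Infinity [simp]: "ec_add l P Infinity = P"
  by (cases P) auto

lemma ec_add_neg [simp]: "ec_add l P (ec_neg P) = Infinity" "ec_add l (ec_neg P) P = Infinity"
  by (cases P; simp)+

lemma ec_add_neg_eq_Infinity: "ec_add l P (ec_neg Q) = Infinity \<Longrightarrow> P = Q"
  by (cases P; cases Q) (auto simp: Let_def split: if_splits)

lemma on_ec_add: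
  assumes "on_ec l P" "on_ec l Q"
  shows "on_ec l (ec_add l P Q)"
proof (cases "P = Infinity \<or> Q = Infinity \<or> P = ec_neg Q")
  case False
  then obtain x1 y1 x2 y2 where PQ: "P = Affine x1 y1" "Q = Affine x2 y2" "\<not> (x1 = x2 \<and> y1 = - y2)"
    by (cases P; cases Q) auto
  obtain s d x3 where add: "ec_add l P Q = Affine x3 (- (s * x3 + d))"
    and v: "x1 + x2 + x3 = s^2 + 1 + l"
      "x1 * x2 + x1 * x3 + x2 * x3 = l - 2 * s * d" "x1 * x2 * x3 = d^2"
    using ec_add_affine[OF assms[unfolded PQ(1,2)] PQ(3)] PQ by metis
  have x1: "x1 = s^2 + 1 + l - x2 - x3" using v(1) by (simp add: algebra_simps)
  \<comment> \<open>By Vieta the cubic minus the square of the line is a product of three linear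
    factors, evaluated here at one of its roots.\<close>
  have "x3 * (x3 - 1) * (x3 - l) - (s * x3 + d)^2
      = x3^3 - (s^2 + 1 + l) * x3^2 + (l - 2 * s * d) * x3 - d^2"
    by (simp add: power2_eq_square power3_eq_cube algebra_simps)
  also have "\<dots> = (x3 - x1) * (x3 - x2) * (x3 - x3)"
    unfolding v[symmetric] by (simp add: power2_eq_square power3_eq_cube algebra_simps)
  finally have "(s * x3 + d)^2 = x3 * (x3 - 1) * (x3 - l)" by simp
  then show ?thesis by (simp only: add on_ec_simps power2_minus)
qed (use assms in auto)

lemma ec_add_commute:
  assumes "on_ec l P" "on_ec l Q"
  shows "ec_add l P Q = ec_add l Q P"
proof (cases "P = Infinity \<or> Q = Infinity")
  case False
  then obtain x1 y1 x2 y2 where PQ: "P = Affine x1 y1" "Q = Affine x2 y2"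
    by (cases P; cases Q) auto
  show ?thesis
  proof (cases "x1 = x2")
    case True
    then have "y1 = y2 \<or> y1 = - y2" using assms by (simp add: PQ power2_eq_iff[symmetric])
    then show ?thesis using True by (auto simp: PQ)
  next
    case False
    have s: "(y1 - y2) / (x1 - x2) = (y2 - y1) / (x2 - x1)"
      by (metis minus_diff_eq minus_divide_divide)
    define s where "s = (y2 - y1) / (x2 - x1)"
    have "s * (x2 - x1) = y2 - y1" using False by (simp add: s_def)
    then show ?thesis using False unfolding PQ
      by (simp add: Let_def s s_def[symmetric] algebra_simps)
  qed
qed auto

lemma (in ec_function_ring) ec_add_assoc:
  assumes P: "on_ec l P" and Q: "on_ec l Q" and S: "on_ec l S"
  shows "ec_add l (ec_add l P Q) S = ec_add l P (ec_add l Q S)" (is "?A = ?B")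
proof -
  note on = on_ec_add P Q S
  have "pt_gens ?A \<asymp> pt_gens (ec_add l P Q) * pt_gens S"
    by (intro pt_gens_add on)
  also have "\<dots> \<asymp> (pt_gens P * pt_gens Q) * pt_gens S"
    by (intro eqv_times pt_gens_add on)
  also have "\<dots> = pt_gens P * (pt_gens Q * pt_gens S)" by (rule mult.assoc)
  also have "\<dots> \<asymp> pt_gens P * pt_gens (ec_add l Q S)"
    by (intro eqv_times2 eqv_refl eqv_sym[OF pt_gens_add] on)
  also have "\<dots> \<asymp> pt_gens ?B"
    by (intro eqv_sym[OF pt_gens_add] on)
  finally have AB: "pt_gens ?A \<asymp> pt_gens ?B" .
  have on': "on_ec l ?A" "on_ec l ?B" by (intro on)+
  have "pt_gens (ec_add l ?A (ec_neg ?B)) \<asymp> pt_gens ?A * pt_gens (ec_neg ?B)"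
    using on' by (simp add: pt_gens_add on_ec_add del: ec_add_neg)
  also have "\<dots> \<asymp> pt_gens ?B * pt_gens (ec_neg ?B)" by (rule eqv_times[OF AB])
  also have "\<dots> \<asymp> {1}" using on' by (intro pt_gens_neg)
  finally have "ec_add l ?A (ec_neg ?B) = Infinity"
    using on' by (simp add: pt_gens_principal on_ec_add del: ec_add_neg)
  then show ?thesis by (rule ec_add_neg_eq_Infinity)
qed

section \<open>Construction of the coordinate ring inside Laurent series\<close>

definition poly_at :: "complex fls \<Rightarrow> complex poly \<Rightarrow> complex fls" where
  "poly_at X p = poly (map_poly fls_const p) X"

lemma poly_at_0 [simp]: "poly_at X 0 = 0"
  by (simp add: poly_at_def)

lemma poly_at_pCons [simp]: "poly_at X (pCons c p) = fls_const c + X * poly_at X p"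
  by (simp add: poly_at_def map_poly_pCons)

lemma poly_at_add: "poly_at X (p + q) = poly_at X p + poly_at X q"
  by (induction p q rule: poly_induct2) (simp_all add: fls_plus_const[symmetric] algebra_simps)

lemma poly_at_smult: "poly_at X (Polynomial.smult c p) = fls_const c * poly_at X p"
  by (induction p) (simp_all add: algebra_simps)

lemma poly_at_mult: "poly_at X (p * q) = poly_at X p * poly_at X q"
  by (induction p) (simp_all add: poly_at_add poly_at_smult algebra_simps)

text \<open>Horner's scheme: each multiplication by \<open>X\<close> raises the pole order by 2, and
  adding a constant cannot change the order of a genuine pole.\<close>

lemma subdegree_poly_at:
  assumes "fls_subdegree X = -2" "p \<noteq> 0"
  shows "poly_at X p \<noteq> 0 \<and> fls_subdegree (poly_at X p) = - 2 * int (degree p)"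
  using assms(2)
proof (induction p)
  case (pCons c p)
  have X: "X \<noteq> 0" using assms(1) by auto
  show ?case
  proof (cases "p = 0")
    case True
    with pCons show ?thesis by auto
  next
    case False
    define g where "g = X * poly_at X p"
    have g: "g \<noteq> 0" "fls_subdegree g = - 2 * int (degree (pCons c p))"
      using pCons.IH[OF False] X assms(1) False by (simp_all add: g_def)
    then have "fls_subdegree (g + fls_const c) = fls_subdegree g"
      using False by (intro fls_subdegree_add_eq1) simp_all
    then have "fls_subdegree (fls_const c + g) = - 2 * int (degree (pCons c p))"
      using g by (simp add: add.commute)
    moreover have "- 2 * int (degree (pCons c p)) < 0" using False by simp
    ultimately show ?thesis unfolding poly_at_pCons g_def[symmetric] by force
  qed
qed simp

text \<open>With uniformizer \<open>t\<close> and \<open>X = t^-2\<close>, the equation of the curve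
  asks for \<open>Y = t^-3 * w\<close> where \<open>w^2 = (1 - t^2) * (1 - l * t^2)\<close>. The
  right side has constant term 1, so \<open>w\<close> exists as a power series.\<close>

lemma ec_function_ring_exists:
  assumes "l \<noteq> 0" "l \<noteq> 1"
  shows "\<exists>R X Y. ec_function_ring l R X Y"
proof -
  define a :: "complex fps" where "a = (1 - fps_X^2) * (1 - fps_const l * fps_X^2)"
  \<comment> \<open>The function argument selects 1 as the root of the constant term 1; the exponent
    2 is written \<open>Suc 1\<close> to match \<open>power_radical\<close>.\<close>
  define w where "w = fps_radical (\<lambda>_ _. 1) (Suc 1) a"
  have a0: "a $ 0 = 1" by (simp add: a_def)
  then have "w ^ Suc 1 = a"
    unfolding w_def by (subst power_radical[symmetric]) simp_all
  then have w2: "w * w = a" by simp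
  have w0: "w $ 0 = 1" by (simp add: w_def)
  define X :: "complex fls" where "X = fls_X_inv^2"
  define Y where "Y = fls_X_inv^3 * fps_to_fls w"
  have dX: "fls_subdegree X = -2" by (simp add: X_def)
  have "fps_to_fls w \<noteq> 0" "fls_subdegree (fps_to_fls w) = 0"
    using w0 by (auto simp: fls_subdegree_fls_to_fps)
  then have dY: "fls_subdegree Y = -3" and Y0: "Y \<noteq> 0" by (simp_all add: Y_def)
  have inv: "fls_X_inv * fls_X = (1 :: complex fls)"
    by (simp add: fls_X_inv_times_conv_shift)
  have "Y^2 = fls_X_inv^6 * fps_to_fls a"
    unfolding w2[symmetric] by (simp add: Y_def fls_times_fps_to_fls power2_eq_square power_numeral_reduce mult_ac)
  also have "fps_to_fls a = (1 - fls_X^2) * (1 - fls_const l * fls_X^2)"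
    by (simp add: a_def fls_times_fps_to_fls fps_to_fls_power)
  also have "fls_X_inv^6 * \<dots> = fls_X_inv^2 * (fls_X_inv^2 - (fls_X_inv * fls_X)^2)
      * (fls_X_inv^2 - fls_const l * (fls_X_inv * fls_X)^2)"
    by (simp only: power_mult_distrib) (simp add: algebra_simps power_numeral_reduce)
  finally have curve: "Y^2 = X * (X - 1) * (X - fls_const l)"
    by (simp only: inv X_def) simp
  let ?A = "poly_at X"
  \<comment> \<open>Closed under products because \<open>Y^2\<close> is a polynomial in
    \<open>X\<close>. The two summands have pole orders of different parity, so their leading terms
    cannot cancel.\<close>
  define R where "R = {?A p + ?A q * Y | p q. True}"
  have R: "?A p + ?A q * Y \<in> R" for p q by (auto simp: R_def)
  show ?thesis
  proof (intro exI, unfold_locales)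
    show "fls_const c \<in> R" for c using R[of "[:c:]" 0] by simp
    show "X \<in> R" using R[of "[:0,1:]" 0] by simp
    show "Y \<in> R" using R[of 0 "[:1:]"] by simp
  next
    fix u v assume "u \<in> R" "v \<in> R"
    then obtain p q p' q' where uv: "u = ?A p + ?A q * Y" "v = ?A p' + ?A q' * Y"
      by (auto simp: R_def)
    have "u + v = ?A (p + p') + ?A (q + q') * Y"
      by (simp add: uv poly_at_add algebra_simps)
    then show "u + v \<in> R" using R by simp
    have "Y * Y = ?A [:0, l, - (1 + l), 1:]"
      using curve by (simp add: power2_eq_square fls_plus_const[symmetric] fls_minus_const[symmetric] algebra_simps)
    moreover have "u * v = ?A (p * p') + ?A (p * q' + q * p') * Y + ?A (q * q') * (Y * Y)"
      by (simp add: uv poly_at_add poly_at_mult algebra_simps)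
    ultimately have "u * v = ?A (p * p' + q * q' * [:0, l, - (1 + l), 1:]) + ?A (p * q' + q * p') * Y"
      by (simp only: poly_at_add poly_at_mult) (simp only: algebra_simps)
    then show "u * v \<in> R" using R by simp
  next
    fix u assume "u \<in> R"
    then obtain p q where u: "u = ?A p + ?A q * Y" by (auto simp: R_def)
    have qY: "?A q * Y \<noteq> 0 \<and> fls_subdegree (?A q * Y) = - 2 * int (degree q) - 3" if "q \<noteq> 0"
      using subdegree_poly_at[OF dX that] Y0 dY by simp
    note p = subdegree_poly_at[OF dX, of p]
    show "fls_subdegree u \<le> 0 \<and> fls_subdegree u \<noteq> -1"
    proof (cases "p = 0 \<or> q = 0")
      case True
      moreover have "2 * int (degree p) \<noteq> 1" by presburger
      ultimately show ?thesis using qY p unfolding u by (cases "p = 0"; cases "q = 0") auto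
    next
      case False
      have ne: "- 2 * int (degree q) - 3 \<noteq> - 2 * int (degree p)" by presburger
      have "fls_subdegree u = - 2 * int (degree p) \<or> fls_subdegree u = - 2 * int (degree q) - 3"
        using fls_subdegree_add_eq1[of "?A p" "?A q * Y"] fls_subdegree_add_eq2[of "?A q * Y" "?A p"]
          qY p False ne unfolding u by (smt (verit))
      then show ?thesis by presburger
    qed
  qed (use assms curve dX dY in auto)
qed

lemma ec_add_assoc:
  assumes "l \<noteq> 0" "l \<noteq> 1" "on_ec l P" "on_ec l Q" "on_ec l S"
  shows "ec_add l (ec_add l P Q) S = ec_add l P (ec_add l Q S)"
  using ec_function_ring_exists[OF assms(1,2)] ec_function_ring.ec_add_assoc assms(3-5) by blast

section \<open>Abelian groups of rank one\<close>

text \<open>The map \<open>f\<close> sends \<open>\<int> \<times> \<int> \<times> \<int>\<close>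
  onto \<open>H\<close>, and the order conditions say that its kernel is
  \<open>0 \<times> 4\<int> \<times> 2\<int>\<close>. The last conclusion covers all isomorphisms at
  once: followed by the first projection each kills torsion, and surjectivity forces the value 1 or
  -1 on \<open>P\<close>.\<close>

lemma (in comm_group) rank_one_subgroup:
  fixes P Q R :: 'a
  assumes PQR: "P \<in> carrier G" "Q \<in> carrier G" "R \<in> carrier G"
    and inf: "\<And>n::nat. n > 0 \<Longrightarrow> P [^] n \<noteq> \<one>"
    and Q: "Q [^] (4::nat) = \<one>" "Q [^] (2::nat) \<noteq> \<one>"
    and R: "R [^] (2::nat) = \<one>" "R \<noteq> \<one>" "R \<noteq> Q [^] (2::nat)"
  obtains H where "subgroup H G" "P \<in> H" "Q \<in> H" "R \<in> H"
    "G\<lparr>carrier := H\<rparr> \<cong> integer_group \<times>\<times> (integer_mod_group 4 \<times>\<times> integer_mod_group 2)"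
    "\<forall>x\<in>H. \<forall>n>0::nat. x [^] n = \<one> \<longrightarrow> (\<exists>(a::int) (b::int). x = Q [^] a \<otimes> R [^] b)"
    "\<forall>h \<in> iso (G\<lparr>carrier := H\<rparr>)
        (integer_group \<times>\<times> (integer_mod_group 4 \<times>\<times> integer_mod_group 2)).
      \<exists>e. (e = 1 \<or> e = - 1) \<and> (\<forall>n T. T \<in> H \<longrightarrow> T [^] (4::nat) = \<one>
        \<longrightarrow> fst (h (P [^] (n::int) \<otimes> T)) = e * n)"
proof -
  let ?Z = "integer_group \<times>\<times> (integer_mod_group 4 \<times>\<times> integer_mod_group 2)"
  define f where "f = (\<lambda>(n::int, a::int, b::int). P [^] n \<otimes> (Q [^] a \<otimes> R [^] b))"
  have f: "f (n, a, b) = P [^] n \<otimes> (Q [^] a \<otimes> R [^] b)" for n a b by (simp add: f_def)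
  define H where "H = range f"
  have Q4: "Q [^] (4::int) = \<one>" and R2: "R [^] (2::int) = \<one>"
    using Q(1) R(1) int_pow_int[of G Q 4] int_pow_int[of G R 2] by simp_all
  have Qmod: "Q [^] (a mod 4) = Q [^] a" for a :: int
  proof -
    have "Q [^] a = Q [^] (4 * (a div 4) + a mod 4)" by simp
    also have "\<dots> = (Q [^] (4::int)) [^] (a div 4) \<otimes> Q [^] (a mod 4)"
      using PQR by (simp only: int_pow_mult int_pow_pow)
    finally show ?thesis using PQR by (simp add: Q4)
  qed
  have Rmod: "R [^] (a mod 2) = R [^] a" for a :: int
  proof -
    have "R [^] a = R [^] (2 * (a div 2) + a mod 2)" by simp
    also have "\<dots> = (R [^] (2::int)) [^] (a div 2) \<otimes> R [^] (a mod 2)"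
      using PQR by (simp only: int_pow_mult int_pow_pow)
    finally show ?thesis using PQR by (simp add: R2)
  qed
  have f_mult: "f (n, a, b) \<otimes> f (n', a', b') = f (n + n', a + a', b + b')" for n a b n' a' b'
    using PQR by (simp add: f int_pow_mult m_ac)
  have f_closed: "f z \<in> carrier G" for z using PQR by (cases z) (simp add: f)
  have f_0: "f (0, 0, 0) = \<one>" by (simp add: f)
  have Pinf: "n = 0" if "P [^] n = \<one>" for n :: int
  proof -
    have "P [^] (nat \<bar>n\<bar>) = \<one>"
    proof (cases "n \<ge> 0")
      case True
      then show ?thesis using that int_pow_int[of G P "nat n"] by simp
    next
      case False
      then show ?thesis using that int_pow_int[of G P "nat (- n)"] int_pow_neg[OF PQR(1), of n] by simp
    qed
    then show ?thesis using inf[of "nat \<bar>n\<bar>"] by fastforce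
  qed
  have tors: "(Q [^] a \<otimes> R [^] b) [^] (4::int) = \<one>" for a b :: int
  proof -
    have "(Q [^] a) [^] (4::int) = (Q [^] (4::int)) [^] a" "(R [^] b) [^] (4::int) = (R [^] (2::int)) [^] (2 * b)"
      using PQR by (simp_all only: int_pow_pow) (simp_all add: mult.commute)
    then show ?thesis using PQR by (simp add: int_pow_distrib Q4 R2)
  qed
  have inj: "n = 0 \<and> a mod 4 = 0 \<and> b mod 2 = 0" if eq: "f (n, a, b) = \<one>" for n a b
  proof -
    \<comment> \<open>The fourth power removes the torsion part and leaves a power of
      \<open>P\<close>.\<close>
    have "\<one> = (P [^] n \<otimes> (Q [^] a \<otimes> R [^] b)) [^] (4::int)" using eq by (simp add: f)
    also have "\<dots> = (P [^] n) [^] (4::int) \<otimes> (Q [^] a \<otimes> R [^] b) [^] (4::int)"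
      using PQR by (intro int_pow_distrib) auto
    also have "\<dots> = P [^] (n * 4)" using PQR by (simp add: tors int_pow_pow)
    finally have n: "n = 0" using Pinf[of "n * 4"] by simp
    have QR: "Q [^] (a mod 4) \<otimes> R [^] (b mod 2) = \<one>" using eq PQR by (simp add: f n Qmod Rmod)
    have Q2: "Q [^] (2::int) \<noteq> \<one>" "R \<noteq> Q [^] (2::int)"
      using Q(2) R(3) int_pow_int[of G Q 2] by simp_all
    have a: "a mod 4 = 0 \<or> a mod 4 = 1 \<or> a mod 4 = 2 \<or> a mod 4 = 3" by presburger
    have b: "b mod 2 = 0 \<or> b mod 2 = 1" by presburger
    have Q1: "Q \<noteq> \<one>" using Q2 PQR by auto
    have Q3: "Q [^] (3::int) \<noteq> \<one>"
    proof
      assume "Q [^] (3::int) = \<one>"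
      then have "Q [^] (3::int) \<otimes> Q [^] (1::int) = Q" using PQR by simp
      then show False using Q1 PQR Q4 by (simp add: int_pow_mult[symmetric] del: int_pow_1)
    qed
    have sq: "Q [^] (2 * c) \<otimes> R [^] (2 :: int) = \<one>" if "Q [^] c \<otimes> R = \<one>" for c :: int
    proof -
      have "(Q [^] c \<otimes> R) [^] (2::int) = (Q [^] c) [^] (2::int) \<otimes> R [^] (2 :: int)"
        using PQR by (intro int_pow_distrib) auto
      then show ?thesis using that PQR by (simp add: int_pow_pow mult.commute)
    qed
    \<comment> \<open>For odd \<open>b\<close>, squaring the relation between \<open>Q\<close> and
      \<open>R\<close> gives \<open>Q^(2 a) = 1\<close>, so \<open>a\<close> is 0 or 2 modulo 4 and
      \<open>R\<close> would be 1 or \<open>Q^2\<close>.\<close>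
    have "b mod 2 = 0"
    proof (rule ccontr)
      assume "b mod 2 \<noteq> 0"
      then have QR1: "Q [^] (a mod 4) \<otimes> R = \<one>" using b QR PQR by auto
      from sq[OF this] have "Q [^] (2 * (a mod 4)) = \<one>" using PQR by (simp add: R2)
      then have "Q [^] ((2 * (a mod 4)) mod 4) = \<one>" by (simp only: Qmod)
      then have "a mod 4 = 0 \<or> a mod 4 = 2" using a Q2 by auto
      then show False
      proof
        assume "a mod 4 = 0" then show False using QR1 R PQR by simp
      next
        assume "a mod 4 = 2"
        then have "Q [^] (2::int) \<otimes> R = Q [^] (2::int) \<otimes> Q [^] (2::int)"
          using QR1 PQR Q4 by (simp add: int_pow_mult[symmetric])
        then show False using PQR Q2 by simp
      qed
    qed
    moreover from this have "Q [^] (a mod 4) = \<one>" using QR PQR by simp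
    then have "a mod 4 = 0" using a Q1 Q2 Q3 PQR by auto
    ultimately show ?thesis using n by simp
  qed
  have f_inv: "inv (f (n, a, b)) = f (- n, - a, - b)" for n a b
    by (rule inv_equality) (simp_all add: f_mult f_0 f_closed)
  have sub: "subgroup H G"
  proof
    show "H \<subseteq> carrier G" using f_closed by (auto simp: H_def)
    show "\<one> \<in> H" unfolding H_def f_0[symmetric] by blast
    fix x assume "x \<in> H"
    then obtain n a b where x: "x = f (n, a, b)" by (auto simp: H_def)
    show "inv x \<in> H" unfolding x f_inv by (simp add: H_def)
    fix y assume "y \<in> H"
    then obtain n' a' b' where y: "y = f (n', a', b')" by (auto simp: H_def)
    show "x \<otimes> y \<in> H" unfolding x y f_mult by (simp add: H_def)
  qed
  have fmod: "f (n, a mod 4, b mod 2) = f (n, a, b)" for n a b by (simp add: f Qmod Rmod)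
  have carr: "carrier ?Z = UNIV \<times> ({0..<4} \<times> {0..<2})"
    by (simp add: DirProd_def carrier_integer_mod_group)
  have f_iso: "f \<in> iso ?Z (G\<lparr>carrier := H\<rparr>)"
  proof (rule isoI)
    show "f \<in> hom ?Z (G\<lparr>carrier := H\<rparr>)"
    proof (rule homI)
      fix x y assume "x \<in> carrier ?Z" "y \<in> carrier ?Z"
      show "f (x \<otimes>\<^bsub>?Z\<^esub> y) = f x \<otimes>\<^bsub>G\<lparr>carrier := H\<rparr>\<^esub> f y"
        by (cases x; cases y) (simp add: f_mult fmod)
    qed (simp add: H_def)
    have "inj_on f (carrier ?Z)"
    proof (rule inj_onI)
      fix x y assume x: "x \<in> carrier ?Z" and y: "y \<in> carrier ?Z" and eq: "f x = f y"
      obtain n a b n' a' b' where xy: "x = (n, a, b)" "y = (n', a', b')" by (cases x; cases y) auto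
      have "f x \<otimes> inv (f y) = \<one>" unfolding eq by (simp add: f_closed)
      then have "f (n - n', a - a', b - b') = \<one>" by (simp add: xy f_inv f_mult)
      from inj[OF this] x y show "x = y"
        unfolding xy carr by (auto; presburger)
    qed
    moreover have "f ` carrier ?Z = H"
    proof
      show "H \<subseteq> f ` carrier ?Z"
      proof
        fix z assume "z \<in> H"
        then obtain n a b where z: "z = f (n, a, b)" by (auto simp: H_def)
        have "(n, a mod 4, b mod 2) \<in> carrier ?Z" unfolding carr by simp
        then show "z \<in> f ` carrier ?Z" unfolding z fmod[of n a b, symmetric] by blast
      qed
    qed (auto simp: H_def)
    ultimately show "bij_betw f (carrier ?Z) (carrier (G\<lparr>carrier := H\<rparr>))"
      by (simp add: bij_betw_def)
  qed
  have grpZ: "group ?Z" by (intro DirProd_group) simp_all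
  have grpH: "group (G\<lparr>carrier := H\<rparr>)" using sub by (rule subgroup_imp_group)
  have "?Z \<cong> G\<lparr>carrier := H\<rparr>" using f_iso by (auto simp: is_iso_def)
  then have iso: "G\<lparr>carrier := H\<rparr> \<cong> ?Z" by (rule group.iso_sym[OF grpZ])
  have "f (1, 0, 0) \<in> H" "f (0, 1, 0) \<in> H" "f (0, 0, 1) \<in> H" by (simp_all add: H_def)
  then have mem: "P \<in> H" "Q \<in> H" "R \<in> H" using PQR by (simp_all add: f)
  have torsion: "\<exists>(a::int) (b::int). x = Q [^] a \<otimes> R [^] b" if x: "x \<in> H" "n > (0::nat)" "x [^] n = \<one>" for x n
  proof -
    obtain m a b where xm: "x = f (m, a, b)" using x by (auto simp: H_def)
    have pw: "f (m, a, b) [^] k = f (int k * m, int k * a, int k * b)" for k :: nat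
      by (induction k) (simp_all add: f_0 f_mult algebra_simps)
    have "m = 0" using inj[of "int n * m" "int n * a" "int n * b"] x pw[of n] by (simp add: xm)
    then have "x = Q [^] a \<otimes> R [^] b" using PQR by (simp add: xm f)
    then show ?thesis by blast
  qed
  have proj: "\<exists>e. (e = 1 \<or> e = - 1) \<and> (\<forall>n T. T \<in> H \<longrightarrow> T [^] (4::nat) = \<one>
        \<longrightarrow> fst (h (P [^] (n::int) \<otimes> T)) = e * n)" if h: "h \<in> iso (G\<lparr>carrier := H\<rparr>) ?Z" for h
  proof -
    define g where "g = (\<lambda>x. fst (h x))"
    have hm: "h (x \<otimes> y) = h x \<otimes>\<^bsub>?Z\<^esub> h y" if "x \<in> H" "y \<in> H" for x y
      using h that by (auto simp: iso_def hom_def)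
    have gm: "g (x \<otimes> y) = g x + g y" if "x \<in> H" "y \<in> H" for x y
      using hm[OF that] by (cases "h x"; cases "h y") (simp add: g_def)
    interpret g: group_hom "G\<lparr>carrier := H\<rparr>" integer_group g
      using grpH by (auto simp: group_hom_def group_hom_axioms_def hom_def gm)
    have gpow: "g (x [^] n) = n * g x" if "x \<in> H" for x and n :: int
      using g.hom_int_pow[of x n] int_pow_consistent[OF sub that, of n] that by simp
    have gtors: "g x = 0" if "x \<in> H" "x [^] (4::nat) = \<one>" for x
      using gpow[OF that(1), of 4] that(2) int_pow_int[of G x 4] g.hom_one by simp
    \<comment> \<open>A preimage of \<open>(1, 0, 0)\<close> is \<open>P^n\<close> times torsion.
      Hence \<open>1 = n * g P\<close>, and \<open>g P\<close> is a unit of \<int>.\<close>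
    have "(1, 0, 0) \<in> carrier ?Z" unfolding carr by simp
    moreover have "h ` H = carrier ?Z" using h by (auto simp: iso_def bij_betw_def)
    ultimately obtain x where x: "x \<in> H" "h x = (1, 0, 0)" by (metis (no_types, lifting) imageE)
    obtain n a b where xn: "x = f (n, a, b)" using x by (auto simp: H_def)
    have HP: "P [^] n \<in> H" for n :: int
      using subgroup_int_pow_closed[OF sub mem(1)] by simp
    have "f (0, a, b) \<in> H" by (simp add: H_def)
    then have QRH: "Q [^] a \<otimes> R [^] b \<in> H" using PQR by (simp add: f)
    have "g (Q [^] a \<otimes> R [^] b) = 0"
      using tors[of a b] int_pow_int[of G _ 4] by (intro gtors QRH) simp
    then have "1 = n * g P"
      using x gm[OF HP QRH, of n] gpow[OF mem(1), of n] by (simp add: xn f g_def)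
    then have "g P = 1 \<or> g P = - 1" by (metis zmult_eq_1_iff)
    moreover have "fst (h (P [^] n \<otimes> T)) = g P * n" if "T \<in> H" "T [^] (4::nat) = \<one>" for n :: int and T
      using gm[OF HP that(1), of n] gpow[OF mem(1), of n] gtors[OF that] by (simp add: g_def)
    ultimately show ?thesis by blast
  qed
  show thesis using torsion proj by (intro that[OF sub mem iso]) blast+
qed

section \<open>Rational points over subfields of the complex numbers\<close>

text \<open>Since \<open>inverse 0 = 0\<close>, closure under inverses can be stated for every
  element, and division is closed without side conditions.\<close>

locale complex_subfield =
  fixes K :: "complex set"
  assumes one_K [simp]: "1 \<in> K"
    and add_K [simp]: "a \<in> K \<Longrightarrow> b \<in> K \<Longrightarrow> a + b \<in> K"
    and uminus_K [simp]: "a \<in> K \<Longrightarrow> - a \<in> K"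
    and mult_K [simp]: "a \<in> K \<Longrightarrow> b \<in> K \<Longrightarrow> a * b \<in> K"
    and inverse_K [simp]: "a \<in> K \<Longrightarrow> inverse a \<in> K"
begin

lemma diff_K [simp]: "a \<in> K \<Longrightarrow> b \<in> K \<Longrightarrow> a - b \<in> K"
  using add_K[of a "- b"] by simp

lemma zero_K [simp]: "0 \<in> K"
  using diff_K[of 1 1] by simp

lemma divide_K [simp]: "a \<in> K \<Longrightarrow> b \<in> K \<Longrightarrow> a / b \<in> K"
  by (simp add: divide_inverse)

lemma power_K [simp]: "a \<in> K \<Longrightarrow> a ^ n \<in> K"
  by (induction n) simp_all

lemma numeral_K [simp]: "numeral n \<in> K"
  by (induction n rule: num.induct) (simp_all only: numeral.simps one_K add_K)

lemma comm_group_ec_group: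
  assumes l: "l \<in> K" "l \<noteq> 0" "l \<noteq> 1"
  shows "comm_group (ec_group l K)"
proof -
  have on: "P \<in> ec_points l K \<Longrightarrow> on_ec l P" for P
    by (auto simp: ec_points_def)
  have pt: "P \<in> ec_points l K \<longleftrightarrow>
      on_ec l P \<and> (\<forall>x y. P = Affine x y \<longrightarrow> x \<in> K \<and> y \<in> K)" for P
    by (cases P) (auto simp: ec_points_def)
  have coord: "\<forall>x y. ec_add l P Q = Affine x y \<longrightarrow> x \<in> K \<and> y \<in> K"
    if "P \<in> ec_points l K" "Q \<in> ec_points l K" for P Q
    using that l(1) by (cases P; cases Q) (simp_all add: pt Let_def)
  have closed: "ec_add l P Q \<in> ec_points l K"
    if "P \<in> ec_points l K" "Q \<in> ec_points l K" for P Q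
    unfolding pt[of "ec_add l P Q"] using coord[OF that] on_ec_add on that by blast
  have neg: "ec_neg P \<in> ec_points l K" if "P \<in> ec_points l K" for P
    using that by (cases P) (auto simp: pt)
  show ?thesis
  proof (rule comm_groupI)
    fix P assume P: "P \<in> carrier (ec_group l K)"
    then show "\<exists>Q\<in>carrier (ec_group l K). Q \<otimes>\<^bsub>ec_group l K\<^esub> P = \<one>\<^bsub>ec_group l K\<^esub>"
      using neg by (intro bexI[of _ "ec_neg P"]) (auto simp: ec_group_def)
  qed (use closed ec_add_assoc[OF l(2,3) on on on] ec_add_commute[OF on on] in
      \<open>auto simp: ec_group_def ec_points_def\<close>)
qed

end

lemma field_complex_ring: "field complex_ring"
proof -
  have "cring complex_ring"
  proof (rule cringI)
    show "abelian_group complex_ring"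
      by (rule abelian_groupI) (auto simp: complex_ring_def algebra_simps intro: exI[of _ "- x" for x])
    show "comm_monoid complex_ring"
      by (rule comm_monoidI) (auto simp: complex_ring_def)
  qed (auto simp: complex_ring_def algebra_simps)
  then show ?thesis
  proof (rule cring.cring_fieldI2)
    fix a assume "a \<in> carrier complex_ring" "a \<noteq> \<zero>\<^bsub>complex_ring\<^esub>"
    then show "\<exists>b\<in>carrier complex_ring. a \<otimes>\<^bsub>complex_ring\<^esub> b = \<one>\<^bsub>complex_ring\<^esub>"
      by (intro bexI[of _ "inverse a"]) (simp_all add: complex_ring_def)
  qed (simp add: complex_ring_def)
qed

lemma complex_subfield_adjoin_Q: "complex_subfield (adjoin_Q S)"
proof -
  interpret field complex_ring by (rule field_complex_ring)
  have um: "\<ominus>\<^bsub>complex_ring\<^esub> a = - a" for a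
    by (rule minus_equality) (simp_all add: complex_ring_def)
  have iv: "inv\<^bsub>complex_ring\<^esub> a = inverse a" if "a \<noteq> 0" for a
    by (rule comm_inv_char) (use that in \<open>simp_all add: complex_ring_def\<close>)
  let ?g = "generate_field complex_ring S"
  have add: "a \<in> ?g \<Longrightarrow> b \<in> ?g \<Longrightarrow> a + b \<in> ?g" for a b
    using generate_field.eng_add[of a complex_ring S b] by (simp add: complex_ring_def)
  have minus: "a \<in> ?g \<Longrightarrow> - a \<in> ?g" for a
    using generate_field.a_inv[of a complex_ring S] by (simp add: um)
  have one: "1 \<in> ?g"
    using generate_field.one[of complex_ring S] by (simp add: complex_ring_def)
  have zero: "0 \<in> ?g" using add[OF one minus[OF one]] by simp
  show ?thesis unfolding adjoin_Q_def
  proof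
    fix a assume a: "a \<in> ?g"
    show "inverse a \<in> ?g"
      using generate_field.m_inv[OF a] iv[of a] zero by (cases "a = 0") (simp_all add: complex_ring_def)
    fix b assume "b \<in> ?g"
    then show "a * b \<in> ?g"
      using generate_field.eng_mult[OF a, of b] by (simp add: complex_ring_def)
  qed (use add minus one in auto)
qed

lemma subset_adjoin_Q: "s \<in> S \<Longrightarrow> s \<in> adjoin_Q S"
  unfolding adjoin_Q_def by (rule generate_field.incl)

lemma complex_subfield_base_field: "complex_subfield (base_field k)"
  by (simp add: base_field_def complex_subfield_adjoin_Q)

lemma base_field_memb:
  "zeta \<in> base_field k" "\<i> \<in> base_field k" "cphi \<in> base_field k"
  "k = 2 \<or> k = 5 \<Longrightarrow> csq phi \<in> base_field k"
proof -
  interpret complex_subfield "base_field k" by (rule complex_subfield_base_field)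
  show z: "zeta \<in> base_field k" and "\<i> \<in> base_field k"
    and "k = 2 \<or> k = 5 \<Longrightarrow> csq phi \<in> base_field k"
    by (auto simp: base_field_def intro: subset_adjoin_Q)
  show "cphi \<in> base_field k" unfolding cphi_zeta using z by simp
qed

lemma curve_param_ne: "curve_param k \<noteq> 0" "curve_param k \<noteq> 1"
proof -
  have "complex_of_real phi = 0 \<longleftrightarrow> phi = 0" "complex_of_real phi + 1 = 0 \<longleftrightarrow> phi + 1 = 0"
    "complex_of_real phi = 1 \<longleftrightarrow> phi = 1" "- complex_of_real phi = 1 \<longleftrightarrow> - phi = 1"
    by (metis of_real_0 of_real_1 of_real_add of_real_eq_iff of_real_minus)+
  then show "curve_param k \<noteq> 0" "curve_param k \<noteq> 1"
    using phi_gt_1 by (auto simp: curve_param_def)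
qed

lemma comm_group_mordell_weil: "comm_group (mordell_weil k)"
proof -
  interpret complex_subfield "base_field k" by (rule complex_subfield_base_field)
  have "curve_param k \<in> base_field k" by (simp add: curve_param_def base_field_memb)
  then show ?thesis unfolding mordell_weil_def
    using curve_param_ne by (rule comm_group_ec_group)
qed

section \<open>Points of infinite order\<close>

definition zphi :: "complex \<Rightarrow> bool" where
  "zphi z \<longleftrightarrow> (\<exists>(a::int) (b::int). z = of_int a + of_int b * cphi)"

text \<open>The elements of \<open>\<int>[\<phi>]\<close> that are nonzero in the residue field with
  four elements, that is, units at the prime 2.\<close>

definition odd_zphi :: "complex \<Rightarrow> bool" where
  "odd_zphi z \<longleftrightarrow> (\<exists>(a::int) (b::int). z = of_int a + of_int b * cphi \<and> (odd a \<or> odd b))"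

lemma cphi_mult: "cphi * cphi = cphi + 1"
  using phi_square by (metis of_real_1 of_real_add of_real_mult power2_eq_square)

lemma zphi_odd: "odd_zphi z \<Longrightarrow> zphi z"
  by (auto simp: zphi_def odd_zphi_def)

lemma zphi_mult_coeff:
  "(of_int a + of_int b * cphi) * (of_int c + of_int d * cphi)
    = of_int (a * c + b * d) + of_int (a * d + b * c + b * d) * cphi"
proof -
  have "(of_int a + of_int b * cphi) * (of_int c + of_int d * cphi)
    = of_int (a * c) + of_int (a * d + b * c) * cphi + of_int (b * d) * (cphi * cphi)"
    by (simp add: algebra_simps)
  then show ?thesis by (simp add: cphi_mult algebra_simps)
qed

lemma zphi_mult: "zphi z \<Longrightarrow> zphi w \<Longrightarrow> zphi (z * w)"
  unfolding zphi_def using zphi_mult_coeff by blast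

lemma zphi_of_int: "zphi (of_int a)"
  unfolding zphi_def by (intro exI[of _ a] exI[of _ 0]) simp

lemma zphi_numeral: "zphi (numeral n)"
  using zphi_of_int[of "numeral n"] by simp

lemma zphi_power: "zphi z \<Longrightarrow> zphi (z ^ n)"
  using zphi_of_int[of 1] by (induction n) (simp_all add: zphi_mult)

text \<open>The polynomial \<open>T^2 - T - 1\<close> is irreducible modulo 2, so the residue ring
  has no zero divisors; the parity cases verify this on coefficients.\<close>

lemma odd_zphi_mult:
  assumes "odd_zphi z" "odd_zphi w"
  shows "odd_zphi (z * w)"
proof -
  obtain a b c d :: int where z: "z = of_int a + of_int b * cphi" "odd a \<or> odd b"
    and w: "w = of_int c + of_int d * cphi" "odd c \<or> odd d"
    using assms unfolding odd_zphi_def by metis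
  have "odd (a * c + b * d) \<or> odd (a * d + b * c + b * d)"
    using z(2) w(2) by (cases "even a"; cases "even b"; cases "even c"; cases "even d") simp_all
  then show ?thesis unfolding odd_zphi_def z w zphi_mult_coeff by blast
qed

lemma odd_zphi_diff_even:
  assumes "odd_zphi z" "zphi w"
  shows "odd_zphi (z - 2 * w)"
proof -
  obtain a b c d :: int where z: "z = of_int a + of_int b * cphi" "odd a \<or> odd b"
    and w: "w = of_int c + of_int d * cphi"
    using assms unfolding odd_zphi_def zphi_def by metis
  have "z - 2 * w = of_int (a - 2 * c) + of_int (b - 2 * d) * cphi"
    by (simp add: z w algebra_simps)
  moreover have "odd (a - 2 * c) \<or> odd (b - 2 * d)" using z(2) by simp
  ultimately show ?thesis unfolding odd_zphi_def by blast
qed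

text \<open>If the element were 0, its norm \<open>a^2 + a b - b^2\<close> would be 0 too, yet it is
  odd unless \<open>a\<close> and \<open>b\<close> are both even.\<close>

lemma odd_zphi_nonzero:
  assumes "odd_zphi z"
  shows "z \<noteq> 0"
proof
  assume "z = 0"
  then obtain a b :: int where ab: "of_int a + of_int b * cphi = 0" "odd a \<or> odd b"
    using assms unfolding odd_zphi_def by metis
  then have "of_int a = - (of_int b * cphi)" by (simp add: add_eq_0_iff)
  then have "(of_int (a * a + a * b - b * b) :: complex)
      = of_int b * of_int b * (cphi * cphi - cphi - 1)"
    by (simp add: algebra_simps)
  then have "a * a + a * b - b * b = 0" unfolding cphi_mult by (metis add_diff_cancel_left' cancel_comm_monoid_add_class.diff_cancel mult_zero_right of_int_eq_0_iff)
  moreover have "odd (a * a + a * b - b * b)"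
    using ab(2) by (cases "even a"; cases "even b") simp_all
  ultimately show False by simp
qed

text \<open>
  The prime 2 is inert in \<open>\<int>[\<phi>]\<close>, so the x-coordinates of level n are those of 2-adic valuation -2n.
\<close>
definition dyadic_level :: "nat \<Rightarrow> complex \<Rightarrow> bool" where
  "dyadic_level n x \<longleftrightarrow> (\<exists>u w. odd_zphi u \<and> odd_zphi w \<and> x = u / (4 ^ n * w))"

text \<open>Clearing denominators between two different levels would write an odd product as twice
  an element of \<open>\<int>[\<phi>]\<close>.\<close>

lemma dyadic_level_unique:
  assumes "dyadic_level n x" "dyadic_level m x"
  shows "n = m"
proof -
  have False if lt: "n < m" and n: "dyadic_level n x" and m: "dyadic_level m x" for n m
  proof -
    obtain u w u' w' where uw: "odd_zphi u" "odd_zphi w" "x = u / (4 ^ n * w)"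
      and uw': "odd_zphi u'" "odd_zphi w'" "x = u' / (4 ^ m * w')"
      using n m unfolding dyadic_level_def by metis
    obtain k where k: "m = n + Suc k" using lt less_imp_Suc_add by auto
    have "u / (4 ^ n * w) = u' / (4 ^ n * (4 * 4 ^ k * w'))"
      using uw(3) uw'(3) by (simp add: k power_add mult_ac)
    moreover have "4 ^ n * w \<noteq> 0" "4 ^ n * (4 * 4 ^ k * w') \<noteq> 0"
      using odd_zphi_nonzero[OF uw(2)] odd_zphi_nonzero[OF uw'(2)] by simp_all
    ultimately have "u * (4 ^ n * (4 * 4 ^ k * w')) = u' * (4 ^ n * w)"
      by (metis frac_eq_eq)
    then have "4 ^ n * (u * (4 * 4 ^ k * w')) = 4 ^ n * (u' * w)" by (simp only: mult_ac)
    then have "u * (4 * 4 ^ k * w') = u' * w" by simp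
    then have "u' * w - 2 * (2 * 4 ^ k * u * w') = 0" by (simp add: mult_ac)
    moreover have "zphi (2 * 4 ^ k * u * w')"
      using uw uw' by (intro zphi_mult zphi_power zphi_numeral) (simp_all add: zphi_odd)
    ultimately show False
      using odd_zphi_nonzero[OF odd_zphi_diff_even[OF odd_zphi_mult[OF uw'(1) uw(2)]]] by blast
  qed
  then show ?thesis using assms by (metis linorder_neqE_nat)
qed

text \<open>From level 1 on the denominator \<open>q\<close> is even, so \<open>u\<close>,
  \<open>u - q\<close>, \<open>u - l q\<close> and \<open>N = u^2 - l q^2\<close> are all odd. The
  duplication formula becomes \<open>N^2 / (4 q u v1 v2)\<close>, whose only new power of 2 is the
  explicit 4.\<close>

lemma dyadic_level_double:
  assumes l: "zphi l" and x: "dyadic_level (Suc n) x"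
  shows "x * (x - 1) * (x - l) \<noteq> 0"
    and "dyadic_level (Suc (Suc n)) ((x^2 - l)^2 / (4 * (x * (x - 1) * (x - l))))"
proof -
  obtain u w where uw: "odd_zphi u" "odd_zphi w" "x = u / (4 ^ Suc n * w)"
    using x unfolding dyadic_level_def by metis
  define q :: complex where "q = 4 ^ Suc n * w"
  have q0: "q \<noteq> 0" using odd_zphi_nonzero[OF uw(2)] by (simp add: q_def)
  have x: "x = u / q" by (simp add: uw q_def)
  have "zphi (2 * 4 ^ n * w)"
    using uw by (intro zphi_mult zphi_power zphi_numeral) (simp_all add: zphi_odd)
  moreover have "q = 2 * (2 * 4 ^ n * w)" by (simp add: q_def)
  ultimately obtain r where r: "zphi r" "q = 2 * r" by blast
  define v1 where "v1 = u - q"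
  define v2 where "v2 = u - l * q"
  define N where "N = u^2 - l * q^2"
  have v1: "odd_zphi v1" using odd_zphi_diff_even[OF uw(1) r(1)] by (simp add: v1_def r)
  have v2: "odd_zphi v2"
    using odd_zphi_diff_even[OF uw(1) zphi_mult[OF l r(1)]] by (simp add: v2_def r mult_ac)
  have "zphi (2 * (l * (r * r)))"
    using zphi_of_int[of 2] r l by (intro zphi_mult) simp_all
  then have "odd_zphi (u * u - 2 * (2 * (l * (r * r))))"
    by (intro odd_zphi_diff_even odd_zphi_mult uw(1))
  also have "u * u - 2 * (2 * (l * (r * r))) = N" by (simp add: N_def r power2_eq_square)
  finally have N: "odd_zphi N" .
  have f: "x * (x - 1) * (x - l) = u * v1 * v2 / q^3"
    using q0 by (simp add: x v1_def v2_def field_simps power3_eq_cube)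
  then show "x * (x - 1) * (x - l) \<noteq> 0"
    using q0 odd_zphi_nonzero v1 v2 uw(1) by simp
  have "(x^2 - l) = N / q^2" using q0 by (simp add: x N_def field_simps power2_eq_square)
  then have "(x^2 - l)^2 / (4 * (x * (x - 1) * (x - l))) = N^2 / q^4 / (4 * (u * v1 * v2 / q^3))"
    unfolding f by (simp add: power_divide)
  also have "\<dots> = N^2 / (4 * q * (u * v1 * v2))"
    using q0 by (simp add: field_simps power_numeral_reduce)
  also have "\<dots> = N * N / (4 ^ Suc (Suc n) * (w * u * v1 * v2))"
    by (simp add: q_def mult_ac power2_eq_square)
  finally have "(x^2 - l)^2 / (4 * (x * (x - 1) * (x - l)))
    = N * N / (4 ^ Suc (Suc n) * (w * u * v1 * v2))" .
  moreover have "odd_zphi (N * N)" "odd_zphi (w * u * v1 * v2)"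
    using N v1 v2 uw by (simp_all add: odd_zphi_mult)
  ultimately show "dyadic_level (Suc (Suc n)) ((x^2 - l)^2 / (4 * (x * (x - 1) * (x - l))))"
    unfolding dyadic_level_def by blast
qed

lemma ec_double_x:
  assumes "on_ec l (Affine x y)" "y \<noteq> 0"
  obtains y' where "ec_add l (Affine x y) (Affine x y)
    = Affine ((x^2 - l)^2 / (4 * (x * (x - 1) * (x - l)))) y'"
proof -
  have y: "y^2 = x * (x - 1) * (x - l)" using assms by simp
  define t where "t = 3 * x^2 - 2 * (1 + l) * x + l"
  have "(t / (2 * y))^2 + (1 + l) - x - x = (t^2 + (1 + l - 2 * x) * (4 * y^2)) / (4 * y^2)"
    using assms(2) by (simp add: field_simps power2_eq_square)
  also have "t^2 + (1 + l - 2 * x) * (4 * y^2) = (x^2 - l)^2"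
    unfolding y t_def by (simp add: algebra_simps power2_eq_square)
  finally show thesis
    using assms(2) y by (intro that) (simp only: ec_add.simps Let_def t_def[symmetric], simp)
qed

lemma (in group) infinite_order_of_inj_powers:
  assumes "P \<in> carrier G" and "inj (\<lambda>n. P [^] (2 ^ Suc n :: nat))" and "N > 0"
  shows "P [^] (N::nat) \<noteq> \<one>"
proof
  assume N: "P [^] N = \<one>"
  have "P [^] a = P [^] (a mod N)" for a :: nat
  proof -
    have "P [^] a = P [^] (N * (a div N) + a mod N)" by simp
    also have "\<dots> = (P [^] N) [^] (a div N) \<otimes> P [^] (a mod N)"
      using assms(1) by (simp only: nat_pow_mult nat_pow_pow)
    finally show ?thesis using assms(1) by (simp add: N)
  qed
  then have "range (\<lambda>n. P [^] (2 ^ Suc n :: nat)) \<subseteq> (\<lambda>i. P [^] i) ` {..<N}"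
    using assms(3) by (auto intro!: image_eqI[where x = "2 * 2 ^ n mod N" for n])
  then have "finite (range (\<lambda>n. P [^] (2 ^ Suc n :: nat)))"
    by (rule finite_subset) simp
  then show False using assms(2) by (simp add: finite_image_iff)
qed

text \<open>The equation for \<open>u\<close> says that the double of the point has abscissa
  \<open>u / 4\<close>, of level 1. Hence \<open>2^(n+1) P\<close> has level \<open>n + 1\<close>,
  and these multiples are pairwise distinct.\<close>

lemma infinite_order_ec_group:
  assumes grp: "group (ec_group l K)" and l: "zphi l"
    and P: "Affine x y \<in> ec_points l K" "y \<noteq> 0"
    and u: "odd_zphi u" "(x^2 - l)^2 = u * (x * (x - 1) * (x - l))"
    and N: "N > 0"
  shows "Affine x y [^]\<^bsub>ec_group l K\<^esub> (N::nat) \<noteq> \<one>\<^bsub>ec_group l K\<^esub>"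
proof -
  interpret group "ec_group l K" by (rule grp)
  have on: "S \<in> ec_points l K \<Longrightarrow> on_ec l S" for S by (auto simp: ec_points_def)
  have car: "carrier (ec_group l K) = ec_points l K" and mult: "monoid.mult (ec_group l K) = ec_add l"
    by (simp_all add: ec_group_def)
  let ?P = "Affine x y"
  have pw: "?P [^]\<^bsub>ec_group l K\<^esub> (2 * m :: nat)
      = ec_add l (?P [^]\<^bsub>ec_group l K\<^esub> m) (?P [^]\<^bsub>ec_group l K\<^esub> m)" for m
    using nat_pow_mult[of ?P m m] P(1) by (simp add: car mult mult_2)
  have lev: "\<exists>x' y'. ?P [^]\<^bsub>ec_group l K\<^esub> (2 ^ Suc n :: nat) = Affine x' y' \<and> dyadic_level (Suc n) x'" for n
  proof (induction n)
    case 0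
    have P1: "?P [^]\<^bsub>ec_group l K\<^esub> (1::nat) = ?P" using P(1) by (simp add: car)
    obtain y' where y': "ec_add l ?P ?P = Affine ((x^2 - l)^2 / (4 * (x * (x - 1) * (x - l)))) y'"
      using ec_double_x[OF on[OF P(1)] P(2)] by metis
    have "x * (x - 1) * (x - l) \<noteq> 0" using on[OF P(1)] P(2) by auto
    then have x: "(x^2 - l)^2 / (4 * (x * (x - 1) * (x - l))) = u / (4 ^ Suc 0 * 1)"
      unfolding u(2) by simp
    have "odd_zphi 1" unfolding odd_zphi_def by (intro exI[of _ 1] exI[of _ 0]) simp
    then have "dyadic_level (Suc 0) ((x^2 - l)^2 / (4 * (x * (x - 1) * (x - l))))"
      unfolding dyadic_level_def using u(1) x by blast
    moreover have "?P [^]\<^bsub>ec_group l K\<^esub> (2 ^ Suc 0 :: nat)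
        = Affine ((x^2 - l)^2 / (4 * (x * (x - 1) * (x - l)))) y'"
      using pw[of 1] unfolding P1 y' by (simp only: power_Suc power_0)
    ultimately show ?case by blast
  next
    case (Suc n)
    then obtain x' y' where S: "?P [^]\<^bsub>ec_group l K\<^esub> (2 ^ Suc n :: nat) = Affine x' y'"
      "dyadic_level (Suc n) x'" by blast
    have "?P [^]\<^bsub>ec_group l K\<^esub> (2 ^ Suc n :: nat) \<in> ec_points l K"
      using nat_pow_closed[of ?P] P(1) by (simp add: car)
    then have on': "on_ec l (Affine x' y')" unfolding S by (rule on)
    moreover have "y' \<noteq> 0" using on' dyadic_level_double(1)[OF l S(2)] by auto
    ultimately obtain y'' where y'': "ec_add l (Affine x' y') (Affine x' y')
        = Affine ((x'^2 - l)^2 / (4 * (x' * (x' - 1) * (x' - l)))) y''"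
      by (rule ec_double_x)
    have "?P [^]\<^bsub>ec_group l K\<^esub> (2 ^ Suc (Suc n) :: nat)
        = Affine ((x'^2 - l)^2 / (4 * (x' * (x' - 1) * (x' - l)))) y''"
      using pw[of "2 ^ Suc n"] unfolding S y'' by (simp only: power_Suc)
    then show ?case using dyadic_level_double(2)[OF l S(2)] by blast
  qed
  have "inj (\<lambda>n. ?P [^]\<^bsub>ec_group l K\<^esub> (2 ^ Suc n :: nat))"
  proof (rule injI)
    fix n m assume "?P [^]\<^bsub>ec_group l K\<^esub> (2 ^ Suc n :: nat) = ?P [^]\<^bsub>ec_group l K\<^esub> (2 ^ Suc m :: nat)"
    then show "n = m" using lev[of n] lev[of m] dyadic_level_unique by force
  qed
  then show ?thesis
    using infinite_order_of_inj_powers[of ?P N] P(1) N by (simp add: car)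
qed

section \<open>Images of the base vertex and the face centers\<close>

fun ec_cnj :: "ec_point \<Rightarrow> ec_point" where
  "ec_cnj Infinity = Infinity"
| "ec_cnj (Affine x y) = Affine (cnj x) (cnj y)"

lemma ec_cnj_neg: "ec_cnj (ec_neg P) = ec_neg (ec_cnj P)"
  by (cases P) simp_all

lemma ec_cnj_cnj [simp]: "ec_cnj (ec_cnj P) = P"
  by (cases P) simp_all

text \<open>The colors along which reflection acts on the curve as conjugation followed by negation.
  For \<open>k = 1\<close> and \<open>k = 4\<close> they are the complement of the two colors
  counted by the splitting, as the signs of the coordinates and the conjugate of a factor
  \<open>\<i>\<close> combine.\<close>

definition flips :: "5 \<Rightarrow> 5 \<Rightarrow> bool" where
  "flips k j \<longleftrightarrow> (j = k \<or> j = k + 2) \<noteq> (k = 1 \<or> k = 4)"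

text \<open>The x-coordinate is made of squares with real coefficients, so all signs drop out of it;
  in the y-coordinate the signs of the coordinates involved multiply to the single sign recorded by
  \<open>flips\<close>.\<close>

lemma nu_reflect:
  "nu k (reflect j p) = (if flips k j then ec_neg (ec_cnj (nu k p)) else ec_cnj (nu k p))"
proof (induction p rule: proj4.abs_induct)
  fix x :: "complex ^ 5"
  assume x: "same_point x x"
  let ?y = "(\<chi> k. color_sgn k j * cnj (x $ k)) :: complex ^ 5"
  have y: "same_point ?y ?y" using reflect.rsp x by (auto simp: rel_fun_def)
  have r: "(6::5) = 1" "(7::5) = 2" by simp_all
  show "nu k (reflect j (abs_proj4 x)) =
    (if flips k j then ec_neg (ec_cnj (nu k (abs_proj4 x))) else ec_cnj (nu k (abs_proj4 x)))"
    unfolding reflect.abs_eq[OF x] nu.abs_eq[OF x] nu.abs_eq[OF y] affine_or_inf_def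
    using exhaust_5[of k] exhaust_5[of j]
    by (elim disjE; hypsubst)
      (simp_all add: color_sgn_def vector_5 flips_def r power_mult_distrib)
qed

text \<open>By \<open>\<phi> + 1 = \<phi>^2\<close> and
  \<open>\<phi> - 1 = \<phi> * (\<phi> - 1)^2\<close>, the square roots in the face centers all
  reduce to that of \<phi>.\<close>

lemma csq_phi: "csq phi ^ 2 = cphi" "csq (phi + 1) = cphi" "csq (phi - 1) = csq phi * (cphi - 1)"
  "csq phi \<noteq> 0" "cphi \<noteq> 0"
proof -
  have p: "phi * phi = phi + 1" using phi_square by (simp add: power2_eq_square)
  show "csq phi ^ 2 = cphi" using phi_pos by (simp flip: of_real_power)
  have "sqrt (phi * phi) = phi" using phi_pos by simp
  then show "csq (phi + 1) = cphi" unfolding p by simp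
  have "phi - 1 = phi * (phi - 1)^2" using p by (simp add: power2_eq_square algebra_simps)
  then have "sqrt (phi - 1) = sqrt (phi * (phi - 1)^2)" by simp
  also have "\<dots> = sqrt phi * (phi - 1)" using phi_gt_1 by (simp add: real_sqrt_mult)
  finally show "csq (phi - 1) = csq phi * (cphi - 1)" by simp
  show "csq phi \<noteq> 0" "cphi \<noteq> 0" using phi_pos by simp_all
qed

lemma same_point_base_face_coords: "same_point (base_face_coords m) (base_face_coords m)"
  using base_face.rsp by (auto simp: rel_fun_def)

lemma phi_ne: "phi \<noteq> 0" "phi \<noteq> 1" "cphi \<noteq> - 1" "- 1 \<noteq> cphi" "cphi \<noteq> 2"
proof -
  show "phi \<noteq> 0" "phi \<noteq> 1" using phi_gt_1 by auto
  have "phi \<noteq> 2"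
  proof
    assume "phi = 2"
    from phi_square[unfolded this] show False by simp
  qed
  then have "cphi \<noteq> of_real (- 1)" "cphi \<noteq> of_real 2"
    using phi_gt_1 unfolding of_real_eq_iff by auto
  then show "cphi \<noteq> - 1" "- 1 \<noteq> cphi" "cphi \<noteq> 2" by auto
qed

lemma csq_mult: "csq phi * csq phi = cphi" "csq phi * (csq phi * w) = cphi * w" "cphi * (cphi * w) = cphi * w + w"
  using csq_phi(1) cphi_mult by (simp_all add: power2_eq_square mult.assoc[symmetric] distrib_right)

section \<open>Values of the five maps at the base face centers\<close>

lemma nu_base_face_1:
  "nu 1 (base_face 1) = Affine 1 0"
  "nu 1 (base_face 2) = Affine (cphi + 1) 0"
  "nu 1 (base_face 3) = Infinity"
  "nu 1 (base_face 4) = Affine (- cphi) ((2 * cphi + 1) * \<i>)"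
  "nu 1 (base_face 5) = Affine 0 0"
  unfolding base_face.abs_eq nu.abs_eq[OF same_point_base_face_coords]
  by (simp_all add: phi_ne base_face_coords_def vector_5 affine_or_inf_def csq_phi power2_eq_square power3_eq_cube cphi_mult csq_mult divide_simps algebra_simps)

lemma nu_base_face_2:
  "nu 2 (base_face 1) = Affine cphi 0"
  "nu 2 (base_face 2) = Affine 1 0"
  "nu 2 (base_face 3) = Affine 0 0"
  "nu 2 (base_face 4) = Infinity"
  "nu 2 (base_face 5) = Affine (cphi + 1) (- cphi * csq phi)"
  unfolding base_face.abs_eq nu.abs_eq[OF same_point_base_face_coords]
  by (simp_all add: phi_ne base_face_coords_def vector_5 affine_or_inf_def csq_phi power2_eq_square power3_eq_cube cphi_mult csq_mult divide_simps algebra_simps)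

lemma nu_base_face_3:
  "nu 3 (base_face 1) = Affine (cphi + 1) (2 * cphi + 1)"
  "nu 3 (base_face 2) = Affine 1 0"
  "nu 3 (base_face 3) = Affine 0 0"
  "nu 3 (base_face 4) = Affine (- cphi) 0"
  "nu 3 (base_face 5) = Infinity"
  unfolding base_face.abs_eq nu.abs_eq[OF same_point_base_face_coords]
  by (simp_all add: phi_ne base_face_coords_def vector_5 affine_or_inf_def csq_phi power2_eq_square power3_eq_cube cphi_mult csq_mult divide_simps algebra_simps)

lemma nu_base_face_4:
  "nu 4 (base_face 1) = Infinity"
  "nu 4 (base_face 2) = Affine (- cphi) ((2 * cphi + 1) * \<i>)"
  "nu 4 (base_face 3) = Affine 0 0"
  "nu 4 (base_face 4) = Affine 1 0"
  "nu 4 (base_face 5) = Affine (cphi + 1) 0"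
  unfolding base_face.abs_eq nu.abs_eq[OF same_point_base_face_coords]
  by (simp_all add: phi_ne base_face_coords_def vector_5 affine_or_inf_def csq_phi power2_eq_square power3_eq_cube cphi_mult csq_mult divide_simps algebra_simps)

lemma nu_base_face_5:
  "nu 5 (base_face 1) = Affine 0 0"
  "nu 5 (base_face 2) = Infinity"
  "nu 5 (base_face 3) = Affine (cphi + 1) (- cphi * csq phi)"
  "nu 5 (base_face 4) = Affine cphi 0"
  "nu 5 (base_face 5) = Affine 1 0"
  unfolding base_face.abs_eq nu.abs_eq[OF same_point_base_face_coords]
  by (simp_all add: phi_ne base_face_coords_def vector_5 affine_or_inf_def csq_phi power2_eq_square power3_eq_cube cphi_mult csq_mult divide_simps algebra_simps)

section \<open>Values of the five maps at the base vertex\<close>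

lemma zeta_power_4: "zeta^4 = zeta^3 - zeta^2 + zeta - 1"
  using zeta_cyclotomic by Groebner_Basis.algebra

lemma cphi_zeta_cubic: "cphi = 1 + zeta^2 - zeta^3"
  unfolding cphi_zeta zeta_power_4 by simp

lemma zeta_nonzero: "zeta \<noteq> 0"
  using zeta_pow_5 by auto

lemma cnj_zeta: "cnj zeta = 1 - zeta + zeta^2 - zeta^3"
proof -
  have z: "zeta = cis (pi / 5)" by (simp add: zeta_def cis_conv_exp mult.commute)
  have "zeta * cnj zeta = 1" by (simp add: z cis_cnj cis_mult)
  moreover have "zeta * (1 - zeta + zeta^2 - zeta^3) = 1" using zeta_power_4 by Groebner_Basis.algebra
  ultimately have "zeta * cnj zeta = zeta * (1 - zeta + zeta^2 - zeta^3)" by simp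
  then show ?thesis using zeta_nonzero by simp
qed

lemma base_vertex_coords_reduced:
  "base_vertex_coords = vector [1, zeta^2 * csq phi, - (zeta^4), - \<i> * zeta, - (zeta^3) * csq phi]"
proof -
  have "zeta^(n + 5) = - (zeta^n)" for n by (simp add: power_add zeta_pow_5)
  from this[of 4] this[of 1] this[of 3] show ?thesis
    by (simp add: base_vertex_coords_def)
qed

lemma quotient_eqI: "d \<noteq> 0 \<Longrightarrow> n = c * d \<Longrightarrow> n / d = (c :: complex)"
  by simp

text \<open>Variables stand for zeta, \<phi>, its root and \<open>\<i>\<close>, so that each
  quotient becomes a polynomial identity modulo their relations. The quotients are those in the maps
  for \<open>k = 1, 3, 4, 5\<close>, in this order; for \<open>k = 2\<close> the denominator is the
  coordinate 1.\<close>

lemma base_vertex_arith: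
  fixes z s i p :: complex
  assumes z: "z^4 = z^3 - z^2 + z - 1" and p: "p = 1 + z^2 - z^3" and s: "s^2 = p"
    and i: "i^2 = -1" and ne: "z \<noteq> 0" "s \<noteq> 0"
  shows "1 / (- (z^3) * s)^2 = z^4 * (p - 1)"
    "z^2 * s * (- (z^4)) * (- i * z) / (- (z^3) * s)^3 = i * z^3 * (p - 1)"
    "(- (z^4))^2 / (z^2 * s)^2 = z^4 * (p - 1)"
    "(- i * z) * (- (z^3) * s) / (z^2 * s)^3 = - i * z^3 * (p - 1)"
    "(- i * z)^2 / (- (z^4))^2 = - (z^4)"
    "(z^2 * s) * (- (z^3) * s) / (- (z^4))^3 = p * z^3"
    "(- (z^3) * s)^2 / (- i * z)^2 = - (z^4) * p"
    "(z^2 * s) * (- (z^4)) / (- i * z)^3 = i * z^3 * s"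
proof -
  have i0: "i \<noteq> 0" using i by auto
  show "1 / (- (z^3) * s)^2 = z^4 * (p - 1)"
    by (rule quotient_eqI) (use ne in simp, use z p s in Groebner_Basis.algebra)
  show "z^2 * s * (- (z^4)) * (- i * z) / (- (z^3) * s)^3 = i * z^3 * (p - 1)"
    by (rule quotient_eqI) (use ne in simp, use z p s in Groebner_Basis.algebra)
  show "(- (z^4))^2 / (z^2 * s)^2 = z^4 * (p - 1)"
    by (rule quotient_eqI) (use ne in simp, use z p s in Groebner_Basis.algebra)
  show "(- i * z) * (- (z^3) * s) / (z^2 * s)^3 = - i * z^3 * (p - 1)"
    by (rule quotient_eqI) (use ne in simp, use z p s in Groebner_Basis.algebra)
  show "(- i * z)^2 / (- (z^4))^2 = - (z^4)"
    by (rule quotient_eqI) (use ne in simp, use z i in Groebner_Basis.algebra)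
  show "(z^2 * s) * (- (z^3) * s) / (- (z^4))^3 = p * z^3"
    by (rule quotient_eqI) (use ne in simp, use z s p in Groebner_Basis.algebra)
  show "(- (z^3) * s)^2 / (- i * z)^2 = - (z^4) * p"
    by (rule quotient_eqI) (use ne i0 in simp, use z s p i in Groebner_Basis.algebra)
  show "(z^2 * s) * (- (z^4)) / (- i * z)^3 = i * z^3 * s"
    by (rule quotient_eqI) (use ne i0 in simp, use z i in Groebner_Basis.algebra)
qed

lemmas base_vertex_quotients =
  base_vertex_arith[OF zeta_power_4 cphi_zeta_cubic csq_phi(1) power2_i zeta_nonzero csq_phi(4)]

lemma same_point_base_vertex_coords: "same_point base_vertex_coords base_vertex_coords"
  using base_vertex.rsp .

text \<open>The maps for 1 and 4, and those for 2 and 5, use different coordinates yet agree at the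
  base vertex, so three computations cover the five cases.\<close>

lemma nu_base_vertex:
  "k = 1 \<or> k = 4 \<Longrightarrow> nu k base_vertex = Affine (1 - zeta - zeta^3) (\<i> * ((cphi + 1) * zeta^3))"
  "k = 2 \<or> k = 5 \<Longrightarrow> nu k base_vertex = Affine (1 + zeta^2) (- (zeta^3) * csq phi)"
  "nu 3 base_vertex = Affine (zeta + zeta^3) ((cphi + 1) * zeta^3)"
proof -
  note z = zeta_power_4 and p = cphi_zeta_cubic
  have n: "zeta \<noteq> 0" "csq phi \<noteq> 0" using zeta_nonzero csq_phi by auto
  note u = base_vertex.abs_eq nu.abs_eq[OF same_point_base_vertex_coords] affine_or_inf_def
  note c = vector_5[of 1 "zeta^2 * csq phi" "- (zeta^4)" "- \<i> * zeta" "- (zeta^3) * csq phi",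
    folded base_vertex_coords_reduced]
  note v = base_vertex_quotients[unfolded mult_1]
  show "nu k base_vertex = Affine (1 - zeta - zeta^3) (\<i> * ((cphi + 1) * zeta^3))" if k: "k = 1 \<or> k = 4"
  proof -
    have "nu 1 base_vertex = Affine (- (2 * cphi + 1) * (zeta^4 * (cphi - 1)) - cphi)
        ((2 * cphi + 1) * (\<i> * zeta^3 * (cphi - 1)))"
      unfolding u c using n by (simp only: v power_one) simp
    moreover have "nu 4 base_vertex = Affine ((cphi + 1) * (- (zeta^4)) - cphi)
        (\<i> * cphi * (cphi * zeta^3))"
      unfolding u c using n by (simp only: v power_one mult_1) simp
    moreover have "- (2 * cphi + 1) * (zeta^4 * (cphi - 1)) - cphi = 1 - zeta - zeta^3"
      "(2 * cphi + 1) * (\<i> * zeta^3 * (cphi - 1)) = \<i> * ((cphi + 1) * zeta^3)"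
      "(cphi + 1) * (- (zeta^4)) - cphi = 1 - zeta - zeta^3"
      "\<i> * cphi * (cphi * zeta^3) = \<i> * ((cphi + 1) * zeta^3)"
      using z p by Groebner_Basis.algebra+
    ultimately show ?thesis using k by auto
  qed
  show "nu k base_vertex = Affine (1 + zeta^2) (- (zeta^3) * csq phi)" if k: "k = 2 \<or> k = 5"
  proof -
    have "nu 2 base_vertex = Affine ((zeta^2 * csq phi)^2 + cphi + 1)
        (\<i> * (- (zeta^4) * (- \<i> * zeta) * (- (zeta^3) * csq phi)))"
      unfolding u c by simp
    moreover have "nu 5 base_vertex = Affine (- (- (zeta^4) * cphi) + cphi + 1) (\<i> * (\<i> * zeta^3 * csq phi))"
      unfolding u c using n by (simp only: v power_one mult_1) simp
    moreover have "(zeta^2 * csq phi)^2 + cphi + 1 = 1 + zeta^2"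
      using z p csq_phi(1) by Groebner_Basis.algebra
    moreover have "\<i> * (- (zeta^4) * (- \<i> * zeta) * (- (zeta^3) * csq phi)) = - (zeta^3) * csq phi"
      using z power2_i by Groebner_Basis.algebra
    moreover have "- (- (zeta^4) * cphi) + cphi + 1 = 1 + zeta^2" using z p by Groebner_Basis.algebra
    moreover have "\<i> * (\<i> * zeta^3 * csq phi) = - (zeta^3) * csq phi"
      using power2_i by Groebner_Basis.algebra
    ultimately show ?thesis using k by auto
  qed
  have "nu 3 base_vertex = Affine ((2 * cphi + 1) * (zeta^4 * (cphi - 1)) + cphi + 1)
      (\<i> * (2 * cphi + 1) * (- \<i> * zeta^3 * (cphi - 1)))"
    unfolding u c using n by (simp only: v power_one mult_1) simp
  moreover have "(2 * cphi + 1) * (zeta^4 * (cphi - 1)) + cphi + 1 = zeta + zeta^3"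
    using z p by Groebner_Basis.algebra
  moreover have "\<i> * (2 * cphi + 1) * (- \<i> * zeta^3 * (cphi - 1)) = (cphi + 1) * zeta^3"
    using z p power2_i by Groebner_Basis.algebra
  ultimately show "nu 3 base_vertex = Affine (zeta + zeta^3) ((cphi + 1) * zeta^3)" by simp
qed

text \<open>Supplying the slope \<open>s\<close> of the chord to \<open>(t, 0)\<close> turns the
  addition into polynomial identities; \<open>ec_add_self\<close> does the same with the tangent
  slope \<open>m\<close>.\<close>

lemma ec_add_two_torsion:
  assumes "y \<noteq> 0" "y = s * (x - t)"
    and "x' = s^2 + 1 + l - x - t" "y' = s * (2 * x + t - (s^2 + 1 + l)) - y"
  shows "Affine x' y' = ec_add l (Affine x y) (Affine t 0)"
proof -
  have xt: "x \<noteq> t" using assms(1,2) by auto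
  then have s: "(0 - y) / (t - x) = s" by (simp add: assms(2) divide_eq_eq algebra_simps)
  show ?thesis using xt unfolding assms(3,4) ec_add.simps Let_def s by (simp add: algebra_simps)
qed

lemma ec_add_self:
  assumes "y \<noteq> 0" "2 * y * m = 3 * x^2 - 2 * (1 + l) * x + l"
    and "m^2 + 1 + l - 2 * x = x'" "m * (3 * x - (m^2 + 1 + l)) - y = y'"
  shows "ec_add l (Affine x y) (Affine x y) = Affine x' y'"
proof -
  have m: "(3 * x^2 - 2 * (1 + l) * x + l) / (2 * y) = m"
    unfolding assms(2)[symmetric] using assms(1) by simp
  show ?thesis using assms(1) unfolding assms(3,4)[symmetric] ec_add.simps Let_def m
    by (simp add: algebra_simps)
qed

lemma two_cphi_1_nonzero: "2 * cphi + 1 \<noteq> 0"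
proof -
  have "complex_of_real (2 * phi + 1) \<noteq> 0" using phi_pos unfolding of_real_eq_0_iff by simp
  then show ?thesis by simp
qed

lemma cphi_square: "cphi^2 = cphi + 1"
  using cphi_mult by (simp add: power2_eq_square)

text \<open>
  \<open>u / 4\<close> is the x-coordinate of the double of the base vertex; \<open>(t, 0)\<close> is both
  the double of \<open>Q\<close> and the difference between the base vertex and plus or minus its complex conjugate.
\<close>
definition curve_data :: "complex \<Rightarrow> complex set \<Rightarrow> ec_point \<Rightarrow> ec_point \<Rightarrow> bool \<Rightarrow> bool" where
  "curve_data l K P Q neg \<longleftrightarrow> (\<exists>x y t u q r.
    P = Affine x y \<and> x \<in> K \<and> y \<in> K \<and> y \<noteq> 0 \<and> y^2 = x * (x - 1) * (x - l)
    \<and> zphi l \<and> odd_zphi u \<and> (x^2 - l)^2 = u * (x * (x - 1) * (x - l))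
    \<and> Q = Affine q r \<and> q \<in> K \<and> r \<in> K \<and> r^2 = q * (q - 1) * (q - l)
    \<and> ec_add l Q Q = Affine t 0 \<and> t \<in> {0, 1, l}
    \<and> (ec_cnj Q = Q \<or> ec_cnj Q = ec_neg Q)
    \<and> ec_cnj P = ec_add l (if neg then ec_neg P else P) (Affine t 0))"

lemma zphi_cphi: "zphi (of_int a + of_int b * cphi)"
  unfolding zphi_def by blast

lemma odd_zphi_cphi: "odd a \<or> odd b \<Longrightarrow> odd_zphi (of_int a + of_int b * cphi)"
  unfolding odd_zphi_def by blast

lemma cnj_zeta_cube: "cnj zeta ^ 3 = - (zeta^2)"
  unfolding cnj_zeta using zeta_power_4 by Groebner_Basis.algebra

lemma cnj_zeta_square: "cnj zeta ^ 2 = - (zeta^3)"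
  unfolding cnj_zeta using zeta_power_4 by Groebner_Basis.algebra

text \<open>The double of \<open>Q\<close> is \<open>(0, 0)\<close>, and conjugation moves the base
  vertex by exactly this point, with no change of sign.\<close>

lemma curve_data_14:
  assumes k: "k = 1 \<or> k = 4"
  shows "curve_data (curve_param k) (base_field k) (nu k base_vertex)
    (Affine (- cphi) ((2 * cphi + 1) * \<i>)) False"
proof -
  interpret complex_subfield "base_field k" by (rule complex_subfield_base_field)
  note K = base_field_memb[of k]
  define x where "x = 1 - zeta - zeta^3"
  define y where "y = \<i> * ((cphi + 1) * zeta^3)"
  define r where "r = (2 * cphi + 1) * \<i>"
  note z = zeta_power_4 and p = cphi_zeta_cubic and i = power2_i and p2 = cphi_square
  have l: "curve_param k = cphi + 1" using k by (simp add: curve_param_def)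
  have y0: "y \<noteq> 0" using phi_ne(3) zeta_nonzero by (auto simp: y_def eq_neg_iff_add_eq_0)
  show ?thesis unfolding curve_data_def l nu_base_vertex(1)[OF k] x_def[symmetric] y_def[symmetric] r_def[symmetric]
  proof (intro exI conjI)
    show "Affine x y = Affine x y" "Affine (- cphi) r = Affine (- cphi) r" by (rule refl)+
    show "x \<in> base_field k" "y \<in> base_field k" "- cphi \<in> base_field k" "r \<in> base_field k"
      using K by (simp_all add: x_def y_def r_def)
    show "y \<noteq> 0" by (rule y0)
    show "y^2 = x * (x - 1) * (x - (cphi + 1))"
      unfolding x_def y_def using z p i by Groebner_Basis.algebra
    show "zphi (cphi + 1)" using zphi_cphi[of 1 1] by (simp add: add.commute)
    show "odd_zphi (2 + cphi)" using odd_zphi_cphi[of 2 1] by simp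
    show "(x^2 - (cphi + 1))^2 = (2 + cphi) * (x * (x - 1) * (x - (cphi + 1)))"
      unfolding x_def using z p by Groebner_Basis.algebra
    show "r^2 = - cphi * (- cphi - 1) * (- cphi - (cphi + 1))"
      unfolding r_def using p2 i by Groebner_Basis.algebra
    have "r \<noteq> 0" using two_cphi_1_nonzero by (simp add: r_def)
    \<comment> \<open>The slope of the tangent at \<open>Q\<close> is
      \<open>- \<i> * (cphi + 1)\<close>.\<close>
    moreover have "2 * r * (- \<i> * (cphi + 1)) = 3 * (- cphi)^2 - 2 * (1 + (cphi + 1)) * (- cphi) + (cphi + 1)"
      unfolding r_def using p2 i by Groebner_Basis.algebra
    moreover have "(- \<i> * (cphi + 1))^2 + 1 + (cphi + 1) - 2 * (- cphi) = 0"
      "(- \<i> * (cphi + 1)) * (3 * (- cphi) - ((- \<i> * (cphi + 1))^2 + 1 + (cphi + 1))) - r = 0"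
      unfolding r_def using p2 i by Groebner_Basis.algebra+
    ultimately show "ec_add (cphi + 1) (Affine (- cphi) r) (Affine (- cphi) r) = Affine 0 0"
      by (rule ec_add_self)
    show "0 \<in> {0, 1, cphi + 1}" by simp
    show "ec_cnj (Affine (- cphi) r) = Affine (- cphi) r \<or>
        ec_cnj (Affine (- cphi) r) = ec_neg (Affine (- cphi) r)"
      by (simp add: r_def)
    \<comment> \<open>The chord from the base vertex to \<open>(0, 0)\<close> has slope
      \<open>- \<i> * cphi\<close>.\<close>
    have "y = (- \<i> * cphi) * (x - 0)"
      unfolding x_def y_def using z p by Groebner_Basis.algebra
    moreover have "cnj x = (- \<i> * cphi)^2 + 1 + (cphi + 1) - x - 0"
    proof -
      have "cnj x = 1 - cnj zeta + zeta^2" by (simp add: x_def cnj_zeta_cube)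
      then show ?thesis unfolding x_def cnj_zeta using z p i by Groebner_Basis.algebra
    qed
    moreover have "cnj y = (- \<i> * cphi) * (2 * x + 0 - ((- \<i> * cphi)^2 + 1 + (cphi + 1))) - y"
    proof -
      have "cnj y = \<i> * ((cphi + 1) * zeta^2)" by (simp add: y_def cnj_zeta_cube)
      then show ?thesis unfolding x_def y_def using z p i by Groebner_Basis.algebra
    qed
    ultimately show "ec_cnj (Affine x y) = ec_add (cphi + 1) (if False then ec_neg (Affine x y) else Affine x y) (Affine 0 0)"
      unfolding ec_cnj.simps if_False by (rule ec_add_two_torsion[OF y0])
  qed
qed

text \<open>Conjugation now reverses the base vertex up to the point \<open>(\<phi>, 0)\<close>; the
  chord from its negative to this point has slope \<open>csq phi\<close>.\<close>

lemma curve_data_25: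
  assumes k: "k = 2 \<or> k = 5"
  shows "curve_data (curve_param k) (base_field k) (nu k base_vertex)
    (Affine (cphi + 1) (- cphi * csq phi)) True"
proof -
  interpret complex_subfield "base_field k" by (rule complex_subfield_base_field)
  note K = base_field_memb[of k]
  define x where "x = 1 + zeta^2"
  define y where "y = - (zeta^3) * csq phi"
  define r where "r = - cphi * csq phi"
  note z = zeta_power_4 and p = cphi_zeta_cubic and p2 = cphi_square and s = csq_phi(1)
  have l: "curve_param k = cphi" using k by (auto simp: curve_param_def)
  have y0: "y \<noteq> 0" using csq_phi zeta_nonzero by (simp add: y_def)
  show ?thesis unfolding curve_data_def l nu_base_vertex(2)[OF k] x_def[symmetric] y_def[symmetric] r_def[symmetric]
  proof (intro exI conjI)
    show "Affine x y = Affine x y" "Affine (cphi + 1) r = Affine (cphi + 1) r" by (rule refl)+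
    show "x \<in> base_field k" "y \<in> base_field k" "cphi + 1 \<in> base_field k" "r \<in> base_field k"
      using K k by (simp_all add: x_def y_def r_def)
    show "y \<noteq> 0" by (rule y0)
    show "y^2 = x * (x - 1) * (x - cphi)"
      unfolding x_def y_def using z p s by Groebner_Basis.algebra
    show "zphi cphi" using zphi_cphi[of 0 1] by simp
    show "odd_zphi (1 + 2 * cphi)" using odd_zphi_cphi[of 1 2] by simp
    show "(x^2 - cphi)^2 = (1 + 2 * cphi) * (x * (x - 1) * (x - cphi))"
      unfolding x_def using z p by Groebner_Basis.algebra
    show "r^2 = (cphi + 1) * (cphi + 1 - 1) * (cphi + 1 - cphi)"
      unfolding r_def using p2 s by Groebner_Basis.algebra
    have "r \<noteq> 0" using csq_phi by (simp add: r_def)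
    moreover have "2 * r * (- cphi * csq phi) = 3 * (cphi + 1)^2 - 2 * (1 + cphi) * (cphi + 1) + cphi"
      unfolding r_def using p2 s by Groebner_Basis.algebra
    moreover have "(- cphi * csq phi)^2 + 1 + cphi - 2 * (cphi + 1) = cphi"
      "(- cphi * csq phi) * (3 * (cphi + 1) - ((- cphi * csq phi)^2 + 1 + cphi)) - r = 0"
      unfolding r_def using p2 s by Groebner_Basis.algebra+
    ultimately show "ec_add cphi (Affine (cphi + 1) r) (Affine (cphi + 1) r) = Affine cphi 0"
      by (rule ec_add_self)
    show "cphi \<in> {0, 1, cphi}" by simp
    show "ec_cnj (Affine (cphi + 1) r) = Affine (cphi + 1) r \<or>
        ec_cnj (Affine (cphi + 1) r) = ec_neg (Affine (cphi + 1) r)"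
      by (simp add: r_def)
    have y0': "- y \<noteq> 0" using y0 by simp
    have "- y = csq phi * (x - cphi)"
      unfolding x_def y_def using z p by Groebner_Basis.algebra
    moreover have "cnj x = csq phi ^ 2 + 1 + cphi - x - cphi"
    proof -
      have "cnj x = 1 - zeta^3" by (simp add: x_def cnj_zeta_square)
      then show ?thesis unfolding x_def using z p s by Groebner_Basis.algebra
    qed
    moreover have "cnj y = csq phi * (2 * x + cphi - (csq phi ^ 2 + 1 + cphi)) - (- y)"
    proof -
      have "cnj y = zeta^2 * csq phi" by (simp add: y_def cnj_zeta_cube)
      then show ?thesis unfolding x_def y_def using z p s by Groebner_Basis.algebra
    qed
    ultimately show "ec_cnj (Affine x y) = ec_add cphi (if True then ec_neg (Affine x y) else Affine x y) (Affine cphi 0)"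
      unfolding ec_cnj.simps ec_neg.simps if_True
      by (rule ec_add_two_torsion[OF y0'])
  qed
qed

text \<open>Again conjugation reverses the base vertex, this time up to \<open>(1, 0)\<close>; the
  tangent at \<open>Q\<close> has slope \<open>cphi + 1\<close> and the chord slope
  \<open>- cphi\<close>.\<close>

lemma curve_data_3:
  "curve_data (curve_param 3) (base_field 3) (nu 3 base_vertex)
    (Affine (cphi + 1) (2 * cphi + 1)) True"
proof -
  interpret complex_subfield "base_field 3" by (rule complex_subfield_base_field)
  note K = base_field_memb[of 3]
  define x where "x = zeta + zeta^3"
  define y where "y = (cphi + 1) * zeta^3"
  define r where "r = 2 * cphi + 1"
  note z = zeta_power_4 and p = cphi_zeta_cubic and p2 = cphi_square
  have l: "curve_param 3 = - cphi" by (simp add: curve_param_def)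
  have y0: "y \<noteq> 0" using phi_ne(3) zeta_nonzero by (auto simp: y_def eq_neg_iff_add_eq_0)
  show ?thesis unfolding curve_data_def l nu_base_vertex(3) x_def[symmetric] y_def[symmetric] r_def[symmetric]
  proof (intro exI conjI)
    show "Affine x y = Affine x y" "Affine (cphi + 1) r = Affine (cphi + 1) r" by (rule refl)+
    show "x \<in> base_field 3" "y \<in> base_field 3" "cphi + 1 \<in> base_field 3" "r \<in> base_field 3"
      using K by (simp_all add: x_def y_def r_def)
    show "y \<noteq> 0" by (rule y0)
    show "y^2 = x * (x - 1) * (x - - cphi)"
      unfolding x_def y_def using z p by Groebner_Basis.algebra
    show "zphi (- cphi)" using zphi_cphi[of 0 "- 1"] by simp
    show "odd_zphi (2 + - cphi)" using odd_zphi_cphi[of 2 "- 1"] by simp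
    show "(x^2 - - cphi)^2 = (2 + - cphi) * (x * (x - 1) * (x - - cphi))"
      unfolding x_def using z p by Groebner_Basis.algebra
    show "r^2 = (cphi + 1) * (cphi + 1 - 1) * (cphi + 1 - - cphi)"
      unfolding r_def using p2 by Groebner_Basis.algebra
    have "r \<noteq> 0" using two_cphi_1_nonzero by (simp add: r_def)
    moreover have "2 * r * (cphi + 1) = 3 * (cphi + 1)^2 - 2 * (1 + - cphi) * (cphi + 1) + - cphi"
      unfolding r_def using p2 by Groebner_Basis.algebra
    moreover have "(cphi + 1)^2 + 1 + - cphi - 2 * (cphi + 1) = 1"
      "(cphi + 1) * (3 * (cphi + 1) - ((cphi + 1)^2 + 1 + - cphi)) - r = 0"
      unfolding r_def using p2 by Groebner_Basis.algebra+
    ultimately show "ec_add (- cphi) (Affine (cphi + 1) r) (Affine (cphi + 1) r) = Affine 1 0"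
      by (rule ec_add_self)
    show "1 \<in> {0, 1, - cphi}" by simp
    show "ec_cnj (Affine (cphi + 1) r) = Affine (cphi + 1) r \<or>
        ec_cnj (Affine (cphi + 1) r) = ec_neg (Affine (cphi + 1) r)"
      by (simp add: r_def)
    have y0': "- y \<noteq> 0" using y0 by simp
    have "- y = (- cphi) * (x - 1)"
      unfolding x_def y_def using z p by Groebner_Basis.algebra
    moreover have "cnj x = (- cphi)^2 + 1 + - cphi - x - 1"
    proof -
      have "cnj x = cnj zeta - zeta^2" by (simp add: x_def cnj_zeta_cube)
      then show ?thesis unfolding x_def cnj_zeta using z p by Groebner_Basis.algebra
    qed
    moreover have "cnj y = (- cphi) * (2 * x + 1 - ((- cphi)^2 + 1 + - cphi)) - (- y)"
    proof -
      have "cnj y = - ((cphi + 1) * zeta^2)" by (simp add: y_def cnj_zeta_cube)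
      then show ?thesis unfolding x_def y_def using z p by Groebner_Basis.algebra
    qed
    ultimately show "ec_cnj (Affine x y) = ec_add (- cphi) (if True then ec_neg (Affine x y) else Affine x y) (Affine 1 0)"
      unfolding ec_cnj.simps ec_neg.simps if_True
      by (rule ec_add_two_torsion[OF y0'])
  qed
qed

section \<open>From reflections along paths to signs of vertices and face centers\<close>

lemma foldl_nbr_exists: "\<exists>cs. foldl nbr ones cs = u \<and> (white u \<longleftrightarrow> even (length cs))"
proof -
  obtain cs where "path_from_to ones cs u" "length cs = card {j. ones j \<noteq> u j}"
    using path_exists by blast
  then show ?thesis unfolding white_def hdist_eq_card path_from_to_def by auto
qed

text \<open>Conjugation and negation are commuting involutions, so only two parities matter: the
  length of the path and its number of flipping edges.\<close>

lemma nu_vertex_pos_path: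
  "nu k (vertex_pos (foldl nbr ones cs)) =
    (let P = (if even (length cs) then nu k base_vertex else ec_cnj (nu k base_vertex))
     in if even (length (filter (flips k) cs)) then P else ec_neg P)"
proof (induction cs rule: rev_induct)
  case (snoc j cs)
  then show ?case
    by (auto simp: vertex_pos_nbr nu_reflect Let_def ec_cnj_neg)
qed (simp add: vertex_pos_ones)

lemma color_splitting_cases: "color_splitting k v u = 1 \<or> color_splitting k v u = - 1"
  by (simp add: color_splitting_def)

text \<open>For \<open>k = 1\<close> and \<open>k = 4\<close> the flipping colors complement those
  of the splitting, so the two parities differ by that of the path length. This reverses the sign at
  black vertices and only there.\<close>

lemma nu_vertex_pos:
  "nu k (vertex_pos u) =
    (let P = (if white u then nu k base_vertex else ec_cnj (nu k base_vertex))
     in if (color_splitting k ones u = 1) = (white u \<or> \<not> (k = 1 \<or> k = 4)) then P else ec_neg P)"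
proof -
  obtain cs where cs: "foldl nbr ones cs = u" "white u \<longleftrightarrow> even (length cs)"
    using foldl_nbr_exists by blast
  let ?S = "\<lambda>j. j = k \<or> j = k + 2"
  have split: "color_splitting k ones u = 1 \<longleftrightarrow> even (length (filter ?S cs))"
    using color_splitting_path[of ones cs u k] cs(1) by (simp add: path_from_to_def)
  have "even (length (filter (flips k) cs)) \<longleftrightarrow>
      (color_splitting k ones u = 1) = (white u \<or> \<not> (k = 1 \<or> k = 4))"
  proof (cases "k = 1 \<or> k = 4")
    case True
    then have "flips k = (\<lambda>j. \<not> ?S j)" by (auto simp: flips_def fun_eq_iff)
    then have len: "length (filter ?S cs) + length (filter (flips k) cs) = length cs"
      using sum_length_filter_compl[of ?S cs] by simp
    have "even (length cs) \<longleftrightarrow>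
        (even (length (filter ?S cs)) \<longleftrightarrow> even (length (filter (flips k) cs)))"
      unfolding len[symmetric] by (rule even_add)
    then show ?thesis unfolding split cs(2) using True by auto
  next
    case False
    then have "flips k = ?S" by (auto simp: flips_def fun_eq_iff)
    then show ?thesis unfolding split using False by simp
  qed
  then show ?thesis using nu_vertex_pos_path[of k cs] unfolding cs by simp
qed

text \<open>Used with three sets stable under conjugation and negation: the identity alone,
  \<open>Q\<close> with its negative, and the nonzero 2-torsion.\<close>

lemma nu_face_pos:
  assumes "nu k (base_face m) \<in> S" "\<And>P. P \<in> S \<Longrightarrow> ec_cnj P \<in> S" "\<And>P. P \<in> S \<Longrightarrow> ec_neg P \<in> S"
  shows "nu k (face_pos m v) \<in> S"
proof -
  have "nu k (face_pos m (foldl nbr ones cs)) \<in> S" for cs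
    by (induction cs rule: rev_induct)
      (simp_all add: face_pos_ones face_pos_nbr nu_reflect assms)
  then show ?thesis using foldl_nbr_exists[of v] by blast
qed

text \<open>Here \<open>a\<close> is the color pair sent to the identity and \<open>b\<close> the
  one sent to the point \<open>Q\<close> of \<open>curve_data\<close>. The last clause provides a
  2-torsion point other than \<open>2 Q\<close>, so that the face centers generate all
  torsion.\<close>

definition face_data :: "5 \<Rightarrow> ec_point \<Rightarrow> 5 \<Rightarrow> 5 \<Rightarrow> bool" where
  "face_data k Q a b \<longleftrightarrow> a \<noteq> b \<and> nu k (base_face a) = Infinity \<and> nu k (base_face b) = Q
    \<and> (\<forall>m. m \<noteq> a \<and> m \<noteq> b \<longrightarrow> (\<exists>r\<in>{0, 1, curve_param k}. nu k (base_face m) = Affine r 0))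
    \<and> (\<forall>r\<in>{0, 1, curve_param k}. \<exists>m. nu k (base_face m) = Affine r 0)"

lemma curve_face_data:
  "\<exists>Q neg a b. curve_data (curve_param k) (base_field k) (nu k base_vertex) Q neg \<and> face_data k Q a b"
proof -
  consider "k = 1" | "k = 2" | "k = 3" | "k = 4" | "k = 5" using exhaust_5 by blast
  then show ?thesis
  proof cases
    case 1
    have "face_data k (Affine (- cphi) ((2 * cphi + 1) * \<i>)) 3 4"
      unfolding 1 face_data_def forall_5 exists_5 nu_base_face_1 by (simp add: curve_param_def)
    then show ?thesis using curve_data_14[of k] 1 by blast
  next
    case 2
    have "face_data k (Affine (cphi + 1) (- cphi * csq phi)) 4 5"
      unfolding 2 face_data_def forall_5 exists_5 nu_base_face_2 by (simp add: curve_param_def)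
    then show ?thesis using curve_data_25[of k] 2 by blast
  next
    case 3
    have "face_data k (Affine (cphi + 1) (2 * cphi + 1)) 5 1"
      unfolding 3 face_data_def forall_5 exists_5 nu_base_face_3 by (simp add: curve_param_def)
    then show ?thesis using curve_data_3 3 by blast
  next
    case 4
    have "face_data k (Affine (- cphi) ((2 * cphi + 1) * \<i>)) 1 2"
      unfolding 4 face_data_def forall_5 exists_5 nu_base_face_4 by (simp add: curve_param_def)
    then show ?thesis using curve_data_14[of k] 4 by blast
  next
    case 5
    have "face_data k (Affine (cphi + 1) (- cphi * csq phi)) 2 3"
      unfolding 5 face_data_def forall_5 exists_5 nu_base_face_5 by (simp add: curve_param_def)
    then show ?thesis using curve_data_25[of k] 5 by blast
  qed
qed

lemma generate_integer_group_unit: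
  assumes "e = 1 \<or> e = (- 1 :: int)"
  shows "generate integer_group {e} = carrier integer_group"
proof -
  interpret group integer_group by simp
  have "n \<in> generate integer_group {e}" for n :: int
  proof -
    have "n = (n * e) * e" using assms by auto
    then show ?thesis unfolding generate_pow[of e, simplified] by blast
  qed
  then show ?thesis by auto
qed

text \<open>The quantifier over \<open>h\<close> makes the claims on the projection to \<int>
  independent of how \<open>G\<close> is identified with the product.\<close>

theorem theorem3p7:
  fixes k :: 5
  shows "\<exists>G. subgroup G (mordell_weil k)
    \<and> mordell_weil k\<lparr>carrier := G\<rparr>
        \<cong> integer_group \<times>\<times> (integer_mod_group 4 \<times>\<times> integer_mod_group 2)
    \<and> (\<forall>u. nu k (vertex_pos u) \<in> G)
    \<and> (\<forall>m v. nu k (face_pos m v) \<in> G)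
    \<and> (\<forall>h \<in> iso (mordell_weil k\<lparr>carrier := G\<rparr>)
              (integer_group \<times>\<times> (integer_mod_group 4 \<times>\<times> integer_mod_group 2)).
          (\<forall>u. generate integer_group {fst (h (nu k (vertex_pos u)))} = carrier integer_group)
        \<and> (\<forall>u w. white u = white w \<longrightarrow>
              (fst (h (nu k (vertex_pos u))) = fst (h (nu k (vertex_pos w)))
                \<longleftrightarrow> color_splitting k ones u = color_splitting k ones w)))
    \<and> {P \<in> G. \<exists>n::nat. n > 0 \<and> P [^]\<^bsub>mordell_weil k\<^esub> n = \<one>\<^bsub>mordell_weil k\<^esub>}
        = generate (mordell_weil k) {nu k (face_pos m v) | m v. True}
    \<and> (\<exists>a b. a \<noteq> b
        \<and> (\<forall>v. nu k (face_pos a v) = \<one>\<^bsub>mordell_weil k\<^esub>)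
        \<and> (\<forall>v. group.ord (mordell_weil k) (nu k (face_pos b v)) = 4)
        \<and> (\<forall>m v. m \<noteq> a \<and> m \<noteq> b \<longrightarrow> group.ord (mordell_weil k) (nu k (face_pos m v)) = 2))"
proof -
  let ?M = "mordell_weil k" and ?P = "nu k base_vertex"
  define l where "l = curve_param k"
  define K where "K = base_field k"
  interpret M: comm_group ?M by (rule comm_group_mordell_weil)
  interpret K: complex_subfield K unfolding K_def by (rule complex_subfield_base_field)
  have M_def: "?M = ec_group l K" by (simp add: mordell_weil_def l_def K_def)
  have car: "carrier ?M = ec_points l K" and mult: "\<And>A B. A \<otimes>\<^bsub>?M\<^esub> B = ec_add l A B"
    and one: "\<one>\<^bsub>?M\<^esub> = Infinity"
    by (simp_all add: M_def ec_group_def)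
  have l0: "l \<noteq> 0" "l \<noteq> 1" unfolding l_def by (rule curve_param_ne)+
  have "cphi \<in> K" unfolding K_def by (rule base_field_memb)
  then have lK: "l \<in> K" by (simp add: l_def curve_param_def)
  have cl: "cnj l = l" by (simp add: l_def curve_param_def)
  obtain Q neg a b where cd: "curve_data l K ?P Q neg" and fd: "face_data k Q a b"
    using curve_face_data[of k] unfolding l_def K_def by blast
  obtain x y t u q r where
    P: "?P = Affine x y" "x \<in> K" "y \<in> K" "y \<noteq> 0" "y^2 = x * (x - 1) * (x - l)"
    and u: "zphi l" "odd_zphi u" "(x^2 - l)^2 = u * (x * (x - 1) * (x - l))"
    and Q: "Q = Affine q r" "q \<in> K" "r \<in> K" "r^2 = q * (q - 1) * (q - l)"
    and QQ: "ec_add l Q Q = Affine t 0" and t: "t \<in> {0, 1, l}"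
    and cQ: "ec_cnj Q = Q \<or> ec_cnj Q = ec_neg Q"
    and cP: "ec_cnj ?P = ec_add l (if neg then ec_neg ?P else ?P) (Affine t 0)"
    using cd unfolding curve_data_def by metis
  have Pc: "?P \<in> carrier ?M" and Qc: "Q \<in> carrier ?M"
    using P Q by (auto simp: car ec_points_def)
  have tors_c: "Affine z 0 \<in> carrier ?M" if "z \<in> {0, 1, l}" for z
    using that lK by (auto simp: car ec_points_def)
  define T where "T = Affine t 0"
  have Tc: "T \<in> carrier ?M" using tors_c t by (simp add: T_def)
  have inv: "inv\<^bsub>?M\<^esub> A = ec_neg A" if "A \<in> carrier ?M" for A
  proof (rule M.inv_equality)
    show "ec_neg A \<otimes>\<^bsub>?M\<^esub> A = \<one>\<^bsub>?M\<^esub>" by (simp add: mult one)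
    show "ec_neg A \<in> carrier ?M" using that by (cases A) (auto simp: car ec_points_def)
  qed (rule that)
  have sq: "A [^]\<^bsub>?M\<^esub> (2::nat) = A \<otimes>\<^bsub>?M\<^esub> A" if "A \<in> carrier ?M" for A
    using that by (simp add: numeral_2_eq_2)
  have two: "Affine z 0 [^]\<^bsub>?M\<^esub> (2::nat) = \<one>\<^bsub>?M\<^esub>" if "z \<in> {0, 1, l}" for z
    using sq[OF tors_c[OF that]] by (simp add: mult one)
  have four: "A [^]\<^bsub>?M\<^esub> (4::nat) = (A [^]\<^bsub>?M\<^esub> (2::nat)) [^]\<^bsub>?M\<^esub> (2::nat)"
    if "A \<in> carrier ?M" for A
    using that by (simp add: M.nat_pow_pow)
  have Q2: "Q [^]\<^bsub>?M\<^esub> (2::nat) = T" using sq[OF Qc] QQ by (simp add: mult T_def)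
  have Q4: "Q [^]\<^bsub>?M\<^esub> (4::nat) = \<one>\<^bsub>?M\<^esub>"
    using four[OF Qc] two[OF t] by (simp add: Q2 T_def)
  \<comment> \<open>Any nonzero 2-torsion point other than \<open>2 Q\<close> generates the torsion
    together with \<open>Q\<close>.\<close>
  obtain r0 where r0: "r0 \<in> {0, 1, l}" "r0 \<noteq> t" using t l0 by (metis insertCI)
  define R where "R = Affine r0 0"
  have Rc: "R \<in> carrier ?M" using tors_c r0 by (simp add: R_def)
  have inf: "?P [^]\<^bsub>?M\<^esub> n \<noteq> \<one>\<^bsub>?M\<^esub>" if "n > 0" for n :: nat
    unfolding P(1) M_def
  proof (rule infinite_order_ec_group[OF _ u(1) _ P(4) u(2,3) that])
    show "group (ec_group l K)" using M.is_group by (simp add: M_def)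
    show "Affine x y \<in> ec_points l K" using Pc by (simp add: car P)
  qed
  have Q2_ne: "Q [^]\<^bsub>?M\<^esub> (2::nat) \<noteq> \<one>\<^bsub>?M\<^esub>" by (simp add: Q2 T_def one)
  have R2: "R [^]\<^bsub>?M\<^esub> (2::nat) = \<one>\<^bsub>?M\<^esub>" using two r0 by (simp add: R_def)
  have R_ne: "R \<noteq> \<one>\<^bsub>?M\<^esub>" by (simp add: R_def one)
  have R_ne_Q2: "R \<noteq> Q [^]\<^bsub>?M\<^esub> (2::nat)" using r0 by (simp add: Q2 T_def R_def)
  obtain H where H: "subgroup H ?M" "?P \<in> H" "Q \<in> H" "R \<in> H"
    and iso: "?M\<lparr>carrier := H\<rparr> \<cong> integer_group \<times>\<times> (integer_mod_group 4 \<times>\<times> integer_mod_group 2)"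
    and tor: "\<forall>x\<in>H. \<forall>n>0::nat. x [^]\<^bsub>?M\<^esub> n = \<one>\<^bsub>?M\<^esub>
      \<longrightarrow> (\<exists>(a::int) (b::int). x = Q [^]\<^bsub>?M\<^esub> a \<otimes>\<^bsub>?M\<^esub> R [^]\<^bsub>?M\<^esub> b)"
    and proj: "\<forall>h \<in> iso (?M\<lparr>carrier := H\<rparr>)
        (integer_group \<times>\<times> (integer_mod_group 4 \<times>\<times> integer_mod_group 2)).
      \<exists>e. (e = 1 \<or> e = - 1) \<and> (\<forall>n T. T \<in> H \<longrightarrow> T [^]\<^bsub>?M\<^esub> (4::nat) = \<one>\<^bsub>?M\<^esub>
        \<longrightarrow> fst (h (?P [^]\<^bsub>?M\<^esub> (n::int) \<otimes>\<^bsub>?M\<^esub> T)) = e * n)"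
    by (rule M.rank_one_subgroup[OF Pc Qc Rc inf Q4 Q2_ne R2 R_ne R_ne_Q2])
  interpret H: subgroup H ?M by (rule H(1))
  have TH: "T \<in> H" using H.m_closed[OF H(3,3)] QQ by (simp add: mult T_def)
  have "T \<otimes>\<^bsub>?M\<^esub> R \<in> H" using TH H by blast
  \<comment> \<open>The third nonzero 2-torsion point is the sum of the other two, so
    \<open>H\<close> contains all of them.\<close>
  moreover have "T \<otimes>\<^bsub>?M\<^esub> R = Affine (1 + l - t - r0) 0"
    using r0 by (simp add: mult T_def R_def Let_def)
  ultimately have tors_H: "Affine z 0 \<in> H" if "z \<in> {0, 1, l}" for z
    using that t r0 TH H(4) unfolding T_def R_def by auto
  have four_tors: "A [^]\<^bsub>?M\<^esub> (4::nat) = \<one>\<^bsub>?M\<^esub>" if "A = Affine z 0" "z \<in> {0, 1, l}" for A z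
    using four[of A] tors_c[OF that(2)] two[OF that(2)] that by simp

  \<comment> \<open>The coefficient of the base point in the image of \<open>v\<close>: the sign of
    \<open>nu_vertex_pos\<close>, with a further -1 at black vertices if conjugation reverses the
    base point up to torsion. For the values of \<open>neg\<close> supplied by the
    \<open>curve_data\<close> lemmas it is the splitting label at white vertices and its opposite at
    black ones.\<close>
  define e :: "vertex \<Rightarrow> int" where "e v =
    (if (color_splitting k ones v = 1) = (white v \<or> \<not> (k = 1 \<or> k = 4)) then 1 else - 1)
    * (if \<not> white v \<and> neg then - 1 else 1)" for v
  have e_unit: "e v = 1 \<or> e v = - 1" for v by (simp add: e_def)
  have invT: "inv\<^bsub>?M\<^esub> T = T" using inv[OF Tc] by (simp add: T_def)
  \<comment> \<open>The torsion part is trivial at white vertices and \<open>T\<close> at black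
    ones; the projection to \<int> forgets it.\<close>
  have vert: "\<exists>A. A \<in> H \<and> A [^]\<^bsub>?M\<^esub> (4::nat) = \<one>\<^bsub>?M\<^esub>
      \<and> nu k (vertex_pos v) = ?P [^]\<^bsub>?M\<^esub> e v \<otimes>\<^bsub>?M\<^esub> A" for v
  proof (cases "white v")
    case True
    then have "nu k (vertex_pos v) = ?P [^]\<^bsub>?M\<^esub> e v \<otimes>\<^bsub>?M\<^esub> \<one>\<^bsub>?M\<^esub>"
      using Pc inv[OF Pc] by (simp add: nu_vertex_pos e_def M.int_pow_neg)
    moreover have "\<one>\<^bsub>?M\<^esub> [^]\<^bsub>?M\<^esub> (4::nat) = \<one>\<^bsub>?M\<^esub>" by (rule M.nat_pow_one)
    ultimately show ?thesis using H.one_closed by blast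
  next
    case False
    have cP': "ec_cnj ?P = (if neg then inv\<^bsub>?M\<^esub> ?P else ?P) \<otimes>\<^bsub>?M\<^esub> T"
      using cP inv[OF Pc] by (simp add: mult T_def)
    have "ec_cnj ?P \<in> carrier ?M" unfolding cP' using Pc Tc by simp
    from inv[OF this] have "ec_neg (ec_cnj ?P) = (if neg then ?P else inv\<^bsub>?M\<^esub> ?P) \<otimes>\<^bsub>?M\<^esub> T"
      unfolding cP' using Pc Tc by (cases neg) (simp_all add: M.inv_mult invT)
    moreover define c where
      "c \<longleftrightarrow> (color_splitting k ones v = 1) = (white v \<or> \<not> (k = 1 \<or> k = 4))"
    have "nu k (vertex_pos v) = (if c then ec_cnj ?P else ec_neg (ec_cnj ?P))"
      using False by (simp only: nu_vertex_pos Let_def c_def if_False)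
    moreover have "e v = (if c then 1 else - 1) * (if neg then - 1 else 1)"
      using False by (simp only: e_def c_def not_False_eq_True simp_thms)
    ultimately have "nu k (vertex_pos v) = ?P [^]\<^bsub>?M\<^esub> e v \<otimes>\<^bsub>?M\<^esub> T"
      using cP' Pc by (cases c; cases neg) (simp_all add: M.int_pow_neg)
    moreover have "T [^]\<^bsub>?M\<^esub> (4::nat) = \<one>\<^bsub>?M\<^esub>" using four_tors t by (simp add: T_def)
    ultimately show ?thesis using TH by blast
  qed

  have face_a: "nu k (face_pos a v) = \<one>\<^bsub>?M\<^esub>" for v
    using nu_face_pos[of k a "{Infinity}" v] fd by (simp add: face_data_def one)
  have face_b: "nu k (face_pos b v) \<in> {Q, inv\<^bsub>?M\<^esub> Q}" for v
    unfolding inv[OF Qc]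
  proof (rule nu_face_pos)
    show "nu k (base_face b) \<in> {Q, ec_neg Q}" using fd by (simp add: face_data_def)
    show "A \<in> {Q, ec_neg Q} \<Longrightarrow> ec_cnj A \<in> {Q, ec_neg Q}" for A
      using cQ by (auto simp: ec_cnj_neg)
  qed auto
  have face_m: "nu k (face_pos m v) \<in> (\<lambda>z. Affine z 0) ` {0, 1, l}" if "m \<noteq> a" "m \<noteq> b" for m v
  proof (rule nu_face_pos)
    show "nu k (base_face m) \<in> (\<lambda>z. Affine z 0) ` {0, 1, l}"
      using fd that by (auto simp: face_data_def l_def)
  qed (auto simp: cl)
  let ?F = "{nu k (face_pos m v) | m v. True}"
  have F: "A \<in> H \<and> A [^]\<^bsub>?M\<^esub> (4::nat) = \<one>\<^bsub>?M\<^esub>" if "A \<in> ?F" for A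
  proof -
    obtain m v where A: "A = nu k (face_pos m v)" using \<open>A \<in> ?F\<close> by blast
    consider "m = a" | "m = b" | "m \<noteq> a" "m \<noteq> b" by blast
    then show ?thesis
    proof cases
      case 1
      then show ?thesis using face_a H.one_closed by (simp add: A)
    next
      case 2
      have "inv\<^bsub>?M\<^esub> Q [^]\<^bsub>?M\<^esub> (4::nat) = \<one>\<^bsub>?M\<^esub>" using Q4 Qc by (simp add: M.nat_pow_inv)
      then show ?thesis using face_b[of v] Q4 H(3) H.m_inv_closed[OF H(3)] 2 by (auto simp: A)
    next
      case 3
      then show ?thesis using face_m[of m v] tors_H four_tors by (auto simp: A)
    qed
  qed
  have "Q = nu k (face_pos b ones)" using fd by (simp add: face_pos_ones face_data_def)
  then have QF: "Q \<in> ?F" by blast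
  obtain m where "nu k (base_face m) = R" using fd r0 by (auto simp: face_data_def R_def l_def)
  then have "R = nu k (face_pos m ones)" by (simp add: face_pos_ones)
  then have RF: "R \<in> ?F" by blast
  have F_car: "?F \<subseteq> carrier ?M" using F H.mem_carrier by blast
  have torsion: "{A \<in> H. \<exists>n::nat. n > 0 \<and> A [^]\<^bsub>?M\<^esub> n = \<one>\<^bsub>?M\<^esub>} = generate ?M ?F"
  proof (intro equalityI subsetI)
    fix A assume "A \<in> {A \<in> H. \<exists>n::nat. n > 0 \<and> A [^]\<^bsub>?M\<^esub> n = \<one>\<^bsub>?M\<^esub>}"
    then obtain c d :: int where A: "A = Q [^]\<^bsub>?M\<^esub> c \<otimes>\<^bsub>?M\<^esub> R [^]\<^bsub>?M\<^esub> d" using tor by blast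
    note gen = M.generate_is_subgroup[OF F_car]
    show "A \<in> generate ?M ?F" unfolding A
      using M.subgroup_int_pow_closed[OF gen] generate.incl[OF QF] generate.incl[OF RF]
      by (intro generate.eng) auto
  next
    fix A assume "A \<in> generate ?M ?F"
    then have "A \<in> H \<and> A [^]\<^bsub>?M\<^esub> (4::nat) = \<one>\<^bsub>?M\<^esub>"
    proof (induction A rule: generate.induct)
      case (inv A)
      then show ?case using F[of A] H.mem_carrier[of A] by (simp add: M.nat_pow_inv)
    next
      case (eng A B)
      then show ?case using H.mem_carrier[of A] H.mem_carrier[of B] by (simp add: M.nat_pow_distrib)
    qed (use F H.one_closed in auto)
    then show "A \<in> {A \<in> H. \<exists>n::nat. n > 0 \<and> A [^]\<^bsub>?M\<^esub> n = \<one>\<^bsub>?M\<^esub>}"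
      by (auto intro: exI[of _ 4])
  qed
  have ord2: "M.ord A = 2" if A: "A \<in> carrier ?M" "A \<noteq> \<one>\<^bsub>?M\<^esub>" "A [^]\<^bsub>?M\<^esub> (2::nat) = \<one>\<^bsub>?M\<^esub>" for A
  proof -
    have "M.ord A dvd 2" using A M.pow_eq_id by blast
    then have "M.ord A \<le> 2" "0 < M.ord A" by (auto intro: dvd_imp_le dvd_pos_nat[of 2])
    moreover have "M.ord A \<noteq> 1" using A M.ord_eq_1 by blast
    ultimately show ?thesis by linarith
  qed
  have "M.ord Q = 4"
  proof -
    have d4: "M.ord Q dvd 4" using Q4 M.pow_eq_id[OF Qc] by blast
    then have "M.ord Q \<le> 4" "0 < M.ord Q" by (auto intro: dvd_imp_le dvd_pos_nat[of 4])
    moreover have "\<not> M.ord Q dvd 2"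
      using M.pow_eq_id[OF Qc, of 2] by (simp add: Q2 T_def one)
    then have "M.ord Q \<noteq> 1" "M.ord Q \<noteq> 2" by auto
    moreover have "M.ord Q \<noteq> 3" using d4 by auto
    ultimately show ?thesis by linarith
  qed
  then have ord_b: "M.ord (nu k (face_pos b v)) = 4" for v
    using face_b[of v] M.ord_inv[OF Qc] by auto
  have ord_m: "M.ord (nu k (face_pos m v)) = 2" if "m \<noteq> a" "m \<noteq> b" for m v
    using face_m[OF that, of v] ord2 tors_c two by (auto simp: one)
  have vert_H: "nu k (vertex_pos v) \<in> H" for v
    using vert[of v] M.subgroup_int_pow_closed[OF H(1,2)] H.m_closed by force
  \<comment> \<open>On vertices of one color, \<open>e\<close> is the label times a fixed
    sign.\<close>
  have white_e: "e v = e w \<longleftrightarrow> color_splitting k ones v = color_splitting k ones w"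
    if "white v = white w" for v w
    using that color_splitting_cases[of k ones v] color_splitting_cases[of k ones w]
    by (auto simp: e_def)
  have proj_vert: "(\<forall>u. generate integer_group {fst (h (nu k (vertex_pos u)))} = carrier integer_group)
        \<and> (\<forall>u w. white u = white w \<longrightarrow>
              (fst (h (nu k (vertex_pos u))) = fst (h (nu k (vertex_pos w)))
                \<longleftrightarrow> color_splitting k ones u = color_splitting k ones w))"
    if h: "h \<in> iso (?M\<lparr>carrier := H\<rparr>) (integer_group \<times>\<times> (integer_mod_group 4 \<times>\<times> integer_mod_group 2))"
    for h
  proof -
    obtain c where c: "c = 1 \<or> c = - 1"
      and "\<And>n T. T \<in> H \<Longrightarrow> T [^]\<^bsub>?M\<^esub> (4::nat) = \<one>\<^bsub>?M\<^esub>
        \<Longrightarrow> fst (h (?P [^]\<^bsub>?M\<^esub> (n::int) \<otimes>\<^bsub>?M\<^esub> T)) = c * n"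
      using bspec[OF proj h] by metis
    then have v: "fst (h (nu k (vertex_pos v))) = c * e v" for v using vert[of v] by metis
    have "c * e v = 1 \<or> c * e v = - 1" for v using c e_unit[of v] by auto
    moreover have "c \<noteq> 0" using c by auto
    ultimately show ?thesis unfolding v by (simp add: generate_integer_group_unit white_e)
  qed
  have "a \<noteq> b" using fd by (simp add: face_data_def)
  with face_a ord_b ord_m have "\<exists>a b. a \<noteq> b
        \<and> (\<forall>v. nu k (face_pos a v) = \<one>\<^bsub>?M\<^esub>) \<and> (\<forall>v. M.ord (nu k (face_pos b v)) = 4)
        \<and> (\<forall>m v. m \<noteq> a \<and> m \<noteq> b \<longrightarrow> M.ord (nu k (face_pos m v)) = 2)" by blast
  moreover have "\<forall>m v. nu k (face_pos m v) \<in> H" using F by blast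
  ultimately show ?thesis using H(1) iso vert_H proj_vert torsion by blast
qed

end
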